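(* In the setting of the context, fix an initial condition $(\xi_0,\tau_0)$ with $\tau_0\ge0$ componentwise. Consider the controlled system, for $i\in\mathcal V$, $j\in\mathcal E$, $$\dot\xi_i=b_i\mathbb 1_{\rho_i}\phi_i+I_{o\rho_i}u_i,\quad \theta_i=\mathbb 1_{\rho_i}^T\xi_i,\qquad \dot\tau_j=\big[\hat b_j\mathbb 1_{\hat\rho_j}H_j(\omega_j)+I_{o\hat\rho_j}\hat u_j\big]^+_{\tau_j},\quad \lambda_j=\mathbb 1_{\hat\rho_j}^T\tau_j,$$ with initial condition $(\xi_0,\tau_0)$, and the optimal control problem $$\min_U\int_0^\infty\|U\|_R^2+\sum_{i\in\mathcal V}q_i+\sum_{j\in\mathcal E}\hat q_j\ dt,\qquad U=\begin{bmatrix}[u_i]_{i\in\mathcal V}^T&[\hat u_j]_{j\in\mathcal E}^T\end{bmatrix}^T,$$ where the minimization is over all stabilizing control inputs $U$, where $R=\mathrm{diag}[\oplus_{i\in\mathcal V}R_i,\ \oplus_{j\in\mathcal E}\hat R_j]$ with $$R_i=\tfrac12\mathrm{diag}\Big[\tfrac1{a_{i2}b_{i2}},\ldots,\tfrac1{a_{i\rho_i}b_{i\rho_i}}\Big],\qquad \hat R_j=\tfrac12\mathrm{diag}\Big[\tfrac1{\hat a_{j2}\hat b_{j2}},\ldots,\tfrac1{\hat a_{j\hat\rho_j}\hat b_{j\hat\rho_j}}\Big],$$ and where $$q_i=(\theta_i-\theta_i^* )\big(\nabla F_i(\theta_i)-\nabla F_i(\theta_i^* )+\eta_i-\eta_i^*\big)+\sum_{k=2}^{\rho_i}\frac{a_{ik}}{2b_{ik}}\xi_{ik}^2,$$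 $$\hat q_j=-(\tau_{j1}-\lambda_j^* )[H_j(\omega_j)]^+_{\tau_{j1}}-\sum_{k=2}^{\hat\rho_j}\tau_{jk}H_j(\omega_j)+\sum_{k=2}^{\hat\rho_j}\frac{\hat a_{jk}}{2\hat b_{jk}}\tau_{jk}^2.$$ Then the optimal solution of this optimal control problem is $U=\underline U=\begin{bmatrix}[\underline u_i]_{i\in\mathcal V}^T&[\underline{\hat u}_j]_{j\in\mathcal E}^T\end{bmatrix}^T$ given by $$\underline u_i=[-a_{i2}\xi_{i2},\ldots,-a_{i\rho_i}\xi_{i\rho_i}]^T,\qquad \underline{\hat u}_j=[-\hat a_{j2}\tau_{j2},\ldots,-\hat a_{j\hat\rho_j}\tau_{j\hat\rho_j}]^T.$$
   Context: Notation: $\|x\|_R^2=x^TRx$; $\oplus$ denotes block-diagonal direct sum; $[a_k]_{k\in K}$ denotes stacking into a column vector; $\mathbb 1_n$, $\mathbb 0_n$ are the vectors of ones and zeros in $\mathbb R^n$; $I_{on}:=\begin{bmatrix}\mathbb 0_{n-1}&I_{n-1}\end{bmatrix}^T\in\mathbb R^{n\times(n-1)}$. For vectors $\sigma,\epsilon$ of equal dimension, $([\sigma]^+_\epsilon)_k=\sigma_k$ if $\epsilon_k>0$, or if $\epsilon_k=0$ and $\sigma_k\ge0$; and $([\sigma]^+_\epsilon)_k=0$ if $\epsilon_k=0$ and $\sigma_k<0$. Optimization problem: $\mathcal V,\mathcal E$ are finite index sets (nodes and edges of a network), $F_i:\mathbb R\to\mathbb R$ ($i\in\mathcal V$) and $H_j:\mathbb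 R\to\mathbb R$ ($j\in\mathcal E$) are convex and continuously differentiable, with locally Lipschitz derivatives, and $\mathcal R\in\mathbb R^{|\mathcal E|\times|\mathcal V|}$ is a given matrix. The problem is to minimize $F(\theta)=\sum_{i\in\mathcal V}F_i(\theta_i)$ over $\theta\in\mathbb R^{|\mathcal V|}$ subject to $H_j(\omega_j)\le0$ for all $j\in\mathcal E$, where $\omega=[\omega_j]_{j\in\mathcal E}=\mathcal R\theta$. Slater's condition holds and $F$ is bounded below on the feasible set. With $\nabla H(\omega)=\mathrm{diag}[\nabla H_j(\omega_j)]_{j\in\mathcal E}$, an optimal solution $(\theta^*,\lambda^* )\in\mathbb R^{|\mathcal V|}\times\mathbb R^{|\mathcal E|}$ is a pair satisfying, with $\omega^*=\mathcal R\theta^*$, the KKT conditions $\nabla F(\theta^* )+\mathcal R^T\nabla H(\omega^* )\lambda^*=0$ and $\lambda_j^*H_j(\omega_j^* )=0$, $\lambda_j^*\ge0$, $H_j(\omega_j^* )\le0$ for all $j\in\mathcal E$. Interconnection variables: $\omega=\mathcal R\theta$, $\eta=[\eta_i]_{i\in\mathcal V}=\mathcal R^T\nabla H(\omega)\lambda$, $\phi=[\phi_i]_{i\in\mathcal V}=-\nabla F(\theta)-\eta$, with $\theta=[\theta_i]$, $\lambda=[\lambda_j]$; and $\eta^*=\mathcal R^T\nabla H(\omega^* )\lambda^*$. States and parameters: $\xi_i=[\xi_{i1},\ldots,\xi_{i\rho_i}]^T\in\mathbb R^{\rho_i}$, $\tau_j=[\tau_{j1},\ldots,\tau_{j\hat\rho_j}]^T\in\mathbb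 R^{\hat\rho_j}_{\ge0}$, with $\rho_i,\hat\rho_j\ge1$ integers; $u_i(t)\in\mathbb R^{\rho_i-1}$, $\hat u_j(t)\in\mathbb R^{\hat\rho_j-1}$. $b_i=\mathrm{diag}[b_{i1},\ldots,b_{i\rho_i}]$, $\hat b_j=\mathrm{diag}[\hat b_{j1},\ldots,\hat b_{j\hat\rho_j}]$ with all diagonal entries positive; $a_{i\rho_i}>\cdots>a_{i2}>0$ and likewise for $\hat a_{jk}$. Stabilizing inputs: with $U=\underline U$ the system is the augmented primal-dual algorithm, assumed to converge from the given initial condition to an equilibrium point at which $(\theta,\lambda)$ equals an optimal solution; $(\theta^*,\lambda^* )$ denotes this particular optimal solution. A control input $U$ (an arbitrary function of time, allowed at time $t$ to depend on the history of the process up to $t$) is stabilizing if the system states converge to an equilibrium point at which $(\theta,\lambda)=(\theta^*,\lambda^* )$. *)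

theory Defs
  imports "HOL-Analysis.Analysis"
begin

(* Data of the optimization problem and gains of the algorithm. Hatted symbols (per edge) carry
   the suffix h. The entries of diag-valued parameters are indexed from 1, and those of a from 2. *)
record ('v, 'e) network =
  nodes :: "'v set"
  edges :: "'e set"
  objF :: "'v \<Rightarrow> real \<Rightarrow> real"
  conH :: "'e \<Rightarrow> real \<Rightarrow> real"
  matR :: "'e \<Rightarrow> 'v \<Rightarrow> real"
  rho :: "'v \<Rightarrow> nat"
  rhoh :: "'e \<Rightarrow> nat"
  gb :: "'v \<Rightarrow> nat \<Rightarrow> real"
  gbh :: "'e \<Rightarrow> nat \<Rightarrow> real"
  ga :: "'v \<Rightarrow> nat \<Rightarrow> real"
  gah :: "'e \<Rightarrow> nat \<Rightarrow> real"

(* A state is a pair (xi, tau) and an input is a pair (u, uh). Only the coordinates listed in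
   state_eq and input_eq below are meaningful: k = 1, ..., rho i for xi, and, keeping the labels
   of the gains a, k = 2, ..., rho i for u; likewise for tau and uh. *)
type_synonym ('v, 'e) state = "('v \<Rightarrow> nat \<Rightarrow> real) \<times> ('e \<Rightarrow> nat \<Rightarrow> real)"
type_synonym ('v, 'e) input = "('v \<Rightarrow> nat \<Rightarrow> real) \<times> ('e \<Rightarrow> nat \<Rightarrow> real)"

(* A control input may use the whole trajectory; causal restricts it to the history. *)
type_synonym ('v, 'e) control = "real \<Rightarrow> (real \<Rightarrow> ('v, 'e) state) \<Rightarrow> ('v, 'e) input"

definition state_eq :: "('v, 'e) network \<Rightarrow> ('v, 'e) state \<Rightarrow> ('v, 'e) state \<Rightarrow> bool" where
  "state_eq S x y \<longleftrightarrow>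
     (\<forall>i\<in>nodes S. \<forall>k\<in>{1..rho S i}. fst x i k = fst y i k) \<and>
     (\<forall>j\<in>edges S. \<forall>k\<in>{1..rhoh S j}. snd x j k = snd y j k)"

definition input_eq :: "('v, 'e) network \<Rightarrow> ('v, 'e) input \<Rightarrow> ('v, 'e) input \<Rightarrow> bool" where
  "input_eq S w w' \<longleftrightarrow>
     (\<forall>i\<in>nodes S. \<forall>k\<in>{2..rho S i}. fst w i k = fst w' i k) \<and>
     (\<forall>j\<in>edges S. \<forall>k\<in>{2..rhoh S j}. snd w j k = snd w' j k)"

definition omega :: "('v, 'e) network \<Rightarrow> ('v \<Rightarrow> real) \<Rightarrow> 'e \<Rightarrow> real" where
  "omega S \<theta> j = (\<Sum>i\<in>nodes S. matR S j i * \<theta> i)"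

definition eta :: "('v, 'e) network \<Rightarrow> ('v \<Rightarrow> real) \<Rightarrow> ('e \<Rightarrow> real) \<Rightarrow> 'v \<Rightarrow> real" where
  "eta S \<theta> l i = (\<Sum>j\<in>edges S. matR S j i * (deriv (conH S j) (omega S \<theta> j) * l j))"

definition phi :: "('v, 'e) network \<Rightarrow> ('v \<Rightarrow> real) \<Rightarrow> ('e \<Rightarrow> real) \<Rightarrow> 'v \<Rightarrow> real" where
  "phi S \<theta> l i = - deriv (objF S i) (\<theta> i) - eta S \<theta> l i"

definition feasible :: "('v, 'e) network \<Rightarrow> ('v \<Rightarrow> real) set" where
  "feasible S = {\<theta>. \<forall>j\<in>edges S. conH S j (omega S \<theta> j) \<le> 0}"

definition slater :: "('v, 'e) network \<Rightarrow> bool" where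
  "slater S \<longleftrightarrow> (\<exists>\<theta>. \<forall>j\<in>edges S. conH S j (omega S \<theta> j) < 0)"

definition optimal_solution :: "('v, 'e) network \<Rightarrow> ('v \<Rightarrow> real) \<Rightarrow> ('e \<Rightarrow> real) \<Rightarrow> bool" where
  "optimal_solution S \<theta> l \<longleftrightarrow>
     (\<forall>i\<in>nodes S. deriv (objF S i) (\<theta> i) + eta S \<theta> l i = 0) \<and>
     (\<forall>j\<in>edges S. l j * conH S j (omega S \<theta> j) = 0 \<and> l j \<ge> 0 \<and> conH S j (omega S \<theta> j) \<le> 0)"

definition convex_C1_loc_lipschitz :: "(real \<Rightarrow> real) \<Rightarrow> bool" where
  "convex_C1_loc_lipschitz f \<longleftrightarrow>
     convex_on UNIV f \<and> f differentiable_on UNIV \<and> continuous_on UNIV (deriv f) \<and>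
     (\<forall>x. \<exists>\<epsilon>>0. \<exists>L. L-lipschitz_on (cball x \<epsilon>) (deriv f))"

definition valid_network :: "('v, 'e) network \<Rightarrow> bool" where
  "valid_network S \<longleftrightarrow>
     finite (nodes S) \<and> finite (edges S) \<and>
     (\<forall>i\<in>nodes S. convex_C1_loc_lipschitz (objF S i)) \<and>
     (\<forall>j\<in>edges S. convex_C1_loc_lipschitz (conH S j)) \<and>
     slater S \<and>
     bdd_below ((\<lambda>\<theta>. \<Sum>i\<in>nodes S. objF S i (\<theta> i)) ` feasible S) \<and>
     (\<forall>i\<in>nodes S. rho S i \<ge> 1 \<and> (\<forall>k\<in>{1..rho S i}. gb S i k > 0) \<and>
        (\<forall>k\<in>{2..rho S i}. ga S i k > 0) \<and> strict_mono_on {2..rho S i} (ga S i)) \<and>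
     (\<forall>j\<in>edges S. rhoh S j \<ge> 1 \<and> (\<forall>k\<in>{1..rhoh S j}. gbh S j k > 0) \<and>
        (\<forall>k\<in>{2..rhoh S j}. gah S j k > 0) \<and> strict_mono_on {2..rhoh S j} (gah S j))"

(* proj s e is one component of [s]^+_e; it is only meaningful for e \<ge> 0. *)
definition proj :: "real \<Rightarrow> real \<Rightarrow> real" where
  "proj s e = (if e > 0 \<or> (e = 0 \<and> s \<ge> 0) then s else 0)"

(* Multiplication by I_o: prepends a zero (inputs are labelled from 2). *)
definition Io :: "(nat \<Rightarrow> real) \<Rightarrow> nat \<Rightarrow> real" where
  "Io w k = (if k = 1 then 0 else w k)"

definition theta :: "('v, 'e) network \<Rightarrow> ('v, 'e) state \<Rightarrow> 'v \<Rightarrow> real" where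
  "theta S x i = (\<Sum>k=1..rho S i. fst x i k)"

definition lam :: "('v, 'e) network \<Rightarrow> ('v, 'e) state \<Rightarrow> 'e \<Rightarrow> real" where
  "lam S x j = (\<Sum>k=1..rhoh S j. snd x j k)"

definition vfield :: "('v, 'e) network \<Rightarrow> ('v, 'e) state \<Rightarrow> ('v, 'e) input \<Rightarrow> ('v, 'e) state" where
  "vfield S x w =
     ((\<lambda>i k. gb S i k * phi S (theta S x) (lam S x) i + Io (fst w i) k),
      (\<lambda>j k. proj (gbh S j k * conH S j (omega S (theta S x) j) + Io (snd w j) k) (snd x j k)))"

definition tau_nonneg :: "('v, 'e) network \<Rightarrow> ('v, 'e) state \<Rightarrow> bool" where
  "tau_nonneg S x \<longleftrightarrow> (\<forall>j\<in>edges S. \<forall>k\<in>{1..rhoh S j}. snd x j k \<ge> 0)"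

definition causal :: "('v, 'e) network \<Rightarrow> ('v, 'e) control \<Rightarrow> bool" where
  "causal S U \<longleftrightarrow>
     (\<forall>t\<ge>0. \<forall>x y. (\<forall>s\<in>{0..t}. state_eq S (x s) (y s)) \<longrightarrow> input_eq S (U t x) (U t y))"

(* x is a Caratheodory solution (locally absolutely continuous, ODE almost everywhere) of the
   system driven by U: the vector field is discontinuous and U need not be continuous in time.
   Measurability of the edge inputs does not follow from that of the vector field. *)
definition solution ::
  "('v, 'e) network \<Rightarrow> ('v, 'e) state \<Rightarrow> ('v, 'e) control \<Rightarrow> (real \<Rightarrow> ('v, 'e) state) \<Rightarrow> bool" where
  "solution S x0 U x \<longleftrightarrow>
     state_eq S (x 0) x0 \<and>
     (\<forall>t\<ge>0. tau_nonneg S (x t)) \<and>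
     (\<forall>i\<in>nodes S. \<forall>k\<in>{2..rho S i}. (\<lambda>t. fst (U t x) i k) \<in> borel_measurable (lebesgue_on {0..})) \<and>
     (\<forall>j\<in>edges S. \<forall>k\<in>{2..rhoh S j}. (\<lambda>t. snd (U t x) j k) \<in> borel_measurable (lebesgue_on {0..})) \<and>
     (\<forall>i\<in>nodes S. \<forall>k\<in>{1..rho S i}. \<forall>t\<ge>0.
        (\<lambda>s. fst (vfield S (x s) (U s x)) i k) absolutely_integrable_on {0..t} \<and>
        fst (x t) i k = fst (x 0) i k + integral {0..t} (\<lambda>s. fst (vfield S (x s) (U s x)) i k)) \<and>
     (\<forall>j\<in>edges S. \<forall>k\<in>{1..rhoh S j}. \<forall>t\<ge>0.
        (\<lambda>s. snd (vfield S (x s) (U s x)) j k) absolutely_integrable_on {0..t} \<and>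
        snd (x t) j k = snd (x 0) j k + integral {0..t} (\<lambda>s. snd (vfield S (x s) (U s x)) j k))"

definition converges_to :: "('v, 'e) network \<Rightarrow> (real \<Rightarrow> ('v, 'e) state) \<Rightarrow> ('v, 'e) state \<Rightarrow> bool" where
  "converges_to S x xe \<longleftrightarrow>
     (\<forall>i\<in>nodes S. \<forall>k\<in>{1..rho S i}. ((\<lambda>t. fst (x t) i k) \<longlongrightarrow> fst xe i k) at_top) \<and>
     (\<forall>j\<in>edges S. \<forall>k\<in>{1..rhoh S j}. ((\<lambda>t. snd (x t) j k) \<longlongrightarrow> snd xe j k) at_top)"

definition equilibrium_under :: "('v, 'e) network \<Rightarrow> ('v, 'e) input \<Rightarrow> ('v, 'e) state \<Rightarrow> bool" where
  "equilibrium_under S w xe \<longleftrightarrow> tau_nonneg S xe \<and> state_eq S (vfield S xe w) (\<lambda>_ _. 0, \<lambda>_ _. 0)"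

(* An equilibrium of the controlled system is one for some constant input value. *)
definition equilibrium :: "('v, 'e) network \<Rightarrow> ('v, 'e) state \<Rightarrow> bool" where
  "equilibrium S xe \<longleftrightarrow> (\<exists>w. equilibrium_under S w xe)"

definition outputs_at ::
  "('v, 'e) network \<Rightarrow> ('v, 'e) state \<Rightarrow> ('v \<Rightarrow> real) \<Rightarrow> ('e \<Rightarrow> real) \<Rightarrow> bool" where
  "outputs_at S x \<theta> l \<longleftrightarrow>
     (\<forall>i\<in>nodes S. theta S x i = \<theta> i) \<and> (\<forall>j\<in>edges S. lam S x j = l j)"

(* A control that uses feedback need not determine its trajectory, so stabilization, cost and
   optimality are notions about a control together with a trajectory that it generates. *)
definition stabilizing ::
  "('v, 'e) network \<Rightarrow> ('v, 'e) state \<Rightarrow> ('v \<Rightarrow> real) \<Rightarrow> ('e \<Rightarrow> real) \<Rightarrow>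
   ('v, 'e) control \<Rightarrow> (real \<Rightarrow> ('v, 'e) state) \<Rightarrow> bool" where
  "stabilizing S x0 \<theta>s ls U x \<longleftrightarrow>
     causal S U \<and> solution S x0 U x \<and>
     (\<exists>xe. equilibrium S xe \<and> outputs_at S xe \<theta>s ls \<and> converges_to S x xe)"

(* The squared norm of an input weighted by the diagonal matrix R. *)
definition input_normsq :: "('v, 'e) network \<Rightarrow> ('v, 'e) input \<Rightarrow> real" where
  "input_normsq S w =
     (\<Sum>i\<in>nodes S. \<Sum>k=2..rho S i. 1 / 2 * (1 / (ga S i k * gb S i k)) * (fst w i k)\<^sup>2) +
     (\<Sum>j\<in>edges S. \<Sum>k=2..rhoh S j. 1 / 2 * (1 / (gah S j k * gbh S j k)) * (snd w j k)\<^sup>2)"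

definition qnode ::
  "('v, 'e) network \<Rightarrow> ('v \<Rightarrow> real) \<Rightarrow> ('e \<Rightarrow> real) \<Rightarrow> ('v, 'e) state \<Rightarrow> 'v \<Rightarrow> real" where
  "qnode S \<theta>s ls x i =
     (theta S x i - \<theta>s i) *
       (deriv (objF S i) (theta S x i) - deriv (objF S i) (\<theta>s i)
        + eta S (theta S x) (lam S x) i - eta S \<theta>s ls i)
     + (\<Sum>k=2..rho S i. ga S i k / (2 * gb S i k) * (fst x i k)\<^sup>2)"

definition qedge ::
  "('v, 'e) network \<Rightarrow> ('e \<Rightarrow> real) \<Rightarrow> ('v, 'e) state \<Rightarrow> 'e \<Rightarrow> real" where
  "qedge S ls x j =
     - (snd x j 1 - ls j) * proj (conH S j (omega S (theta S x) j)) (snd x j 1)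
     - (\<Sum>k=2..rhoh S j. snd x j k * conH S j (omega S (theta S x) j))
     + (\<Sum>k=2..rhoh S j. gah S j k / (2 * gbh S j k) * (snd x j k)\<^sup>2)"

definition running_cost ::
  "('v, 'e) network \<Rightarrow> ('v \<Rightarrow> real) \<Rightarrow> ('e \<Rightarrow> real) \<Rightarrow> ('v, 'e) state \<Rightarrow> ('v, 'e) input \<Rightarrow> real" where
  "running_cost S \<theta>s ls x w =
     input_normsq S w + (\<Sum>i\<in>nodes S. qnode S \<theta>s ls x i) + (\<Sum>j\<in>edges S. qedge S ls x j)"

(* The integral over [0, \<infinity>) as an extended real, positive part minus negative part; it can be
   \<infinity>. The second term vanishes along solutions, by convexity and the KKT conditions. *)
definition total_cost ::
  "('v, 'e) network \<Rightarrow> ('v \<Rightarrow> real) \<Rightarrow> ('e \<Rightarrow> real) \<Rightarrow>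
   ('v, 'e) control \<Rightarrow> (real \<Rightarrow> ('v, 'e) state) \<Rightarrow> ereal" where
  "total_cost S \<theta>s ls U x =
     enn2ereal (\<integral>\<^sup>+ t. ennreal (running_cost S \<theta>s ls (x t) (U t x)) \<partial>lebesgue_on {0..})
     - enn2ereal (\<integral>\<^sup>+ t. ennreal (- running_cost S \<theta>s ls (x t) (U t x)) \<partial>lebesgue_on {0..})"

definition optimal_control ::
  "('v, 'e) network \<Rightarrow> ('v, 'e) state \<Rightarrow> ('v \<Rightarrow> real) \<Rightarrow> ('e \<Rightarrow> real) \<Rightarrow>
   ('v, 'e) control \<Rightarrow> (real \<Rightarrow> ('v, 'e) state) \<Rightarrow> bool" where
  "optimal_control S x0 \<theta>s ls U x \<longleftrightarrow>
     stabilizing S x0 \<theta>s ls U x \<and>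
     (\<forall>U' x'. stabilizing S x0 \<theta>s ls U' x' \<longrightarrow> total_cost S \<theta>s ls U x \<le> total_cost S \<theta>s ls U' x')"

definition apd_feedback :: "('v, 'e) network \<Rightarrow> ('v, 'e) state \<Rightarrow> ('v, 'e) input" where
  "apd_feedback S x = ((\<lambda>i k. - ga S i k * fst x i k), (\<lambda>j k. - gah S j k * snd x j k))"

definition apd_control :: "('v, 'e) network \<Rightarrow> ('v, 'e) control" where
  "apd_control S t x = apd_feedback S (x t)"

(* x is a trajectory of the augmented primal-dual algorithm. *)
definition apd_converges ::
  "('v, 'e) network \<Rightarrow> ('v, 'e) state \<Rightarrow> ('v \<Rightarrow> real) \<Rightarrow> ('e \<Rightarrow> real) \<Rightarrow>
   (real \<Rightarrow> ('v, 'e) state) \<Rightarrow> bool" where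
  "apd_converges S x0 \<theta>s ls x \<longleftrightarrow>
     solution S x0 (apd_control S) x \<and>
     (\<exists>xe. equilibrium_under S (apd_feedback S xe) xe \<and> outputs_at S xe \<theta>s ls \<and> converges_to S x xe)"

end

theory Submission
  imports Defs
begin

text \<open>Let \<open>V\<close> be half the squared distance, weighted by the inverse gains, of the state to the one
  with \<open>\<xi>\<^sub>i\<^sub>1 = \<theta>\<^sub>i\<^sup>*\<close>, \<open>\<tau>\<^sub>j\<^sub>1 = \<lambda>\<^sub>j\<^sup>*\<close> and zero auxiliary states. Because a projected component satisfies
  \<open>\<tau> [\<sigma>]\<^sup>+ = \<tau> \<sigma>\<close>, completing the square shows that the running cost is \<open>- dV/dt\<close> plus the weighted
  squared norm of \<open>U - U\<^sub>f\<^sub>b\<close>, where \<open>U\<^sub>f\<^sub>b\<close> is the primal-dual feedback. Convexity and the KKT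
  conditions bound the running cost below by a positive definite quadratic form in the auxiliary
  states. Hence a stabilizing control has infinite cost unless the auxiliary states tend to zero,
  and then \<open>V\<close> tends to zero and the cost equals \<open>V(x\<^sub>0)\<close> plus the integral of the squared norm.\<close>

section \<open>Absolutely continuous functions and dissipation\<close>

lemma convex_C1_above_tangent:
  assumes "convex_C1_loc_lipschitz f"
  shows "deriv f x * (y - x) \<le> f y - f x"
proof -
  have cx: "convex_on UNIV f" and "f differentiable (at x)"
    using assms by (auto simp: convex_C1_loc_lipschitz_def differentiable_on_def)
  then have "(f has_field_derivative deriv f x) (at x)"
    using DERIV_deriv_iff_real_differentiable by blast
  from convex_on_imp_above_tangent[OF cx _ _ _ this, of y] show ?thesis by simp
qed

text \<open>Adding the tangent inequalities at the two points cancels the function values.\<close>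

lemma convex_C1_deriv_mono:
  assumes "convex_C1_loc_lipschitz f"
  shows "0 \<le> (x - y) * (deriv f x - deriv f y)"
  using convex_C1_above_tangent[OF assms, of x y] convex_C1_above_tangent[OF assms, of y x]
  by (simp add: algebra_simps)

text \<open>The estimate adds up over adjacent intervals because the increments of \<open>m\<close>
  telescope, so bisection glues the local bounds into one on the whole interval; then
  \<open>e\<close> tends to 0. This takes the place of differentiation almost everywhere, with
  \<open>m\<close> an indefinite integral of an absolute value.\<close>

lemma bounded_increments_imp_eq:
  fixes G m :: "real \<Rightarrow> real"
  assumes "a \<le> b"
    and local: "\<And>x e. \<lbrakk>a \<le> x; x \<le> b; e > 0\<rbrakk> \<Longrightarrow> \<exists>d>0. \<forall>u v. a \<le> u \<and> u \<le> x \<and> x \<le> v \<and> v \<le> b \<and> v - u < d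
        \<longrightarrow> \<bar>G v - G u\<bar> \<le> e * (m v - m u)"
  shows "G a = G b"
proof -
  have *: "\<bar>G b - G a\<bar> \<le> e * (m b - m a)" if "e > 0" for e
  proof -
    \<comment> \<open>The guard makes \<open>P\<close> trivially true for intervals that leave
      \<open>{a..b}\<close>, on which nothing is assumed.\<close>
    define P where "P u v \<longleftrightarrow> (a \<le> u \<and> u \<le> v \<and> v \<le> b \<longrightarrow> \<bar>G v - G u\<bar> \<le> e * (m v - m u))" for u v
    have "P a b" using \<open>a \<le> b\<close>
    proof (induction rule: Bolzano)
      case (trans u v w)
      then show ?case by (auto simp: P_def algebra_simps)
    next
      case (local x)
      then show ?case using assms(2)[of x e] \<open>e > 0\<close> by (fastforce simp: P_def)
    qed
    then show ?thesis using \<open>a \<le> b\<close> by (simp add: P_def)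
  qed
  have "((\<lambda>e. e * (m b - m a)) \<longlongrightarrow> 0 * (m b - m a)) (at_right 0)"
    by (intro tendsto_intros)
  then have "\<bar>G b - G a\<bar> \<le> 0 * (m b - m a)"
    by (rule tendsto_lowerbound) (use * in \<open>auto simp: eventually_at_right_less eventually_at_filter\<close>)
  then show ?thesis by simp
qed

text \<open>Chain rule for the square of an absolutely continuous \<open>X\<close> with derivative
  \<open>f\<close> almost everywhere. Pointwise derivatives are avoided: the defect \<open>G\<close>
  between the square and twice the integral has increments that are arbitrarily small multiples of
  those of \<open>m\<close>.\<close>

lemma indefinite_integral_square:
  fixes f X :: "real \<Rightarrow> real"
  assumes "0 \<le> T"
    and f: "f absolutely_integrable_on {0..T}"
    and X: "\<And>t. t \<in> {0..T} \<Longrightarrow> X t = X 0 + integral {0..t} f"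
  shows "(\<lambda>t. (X t - c) * f t) absolutely_integrable_on {0..T}"
    and "integral {0..T} (\<lambda>t. (X t - c) * f t) = ((X T - c)\<^sup>2 - (X 0 - c)\<^sup>2) / 2"
proof -
  have fi: "f integrable_on {0..T}"
    using f by (simp add: absolutely_integrable_on_def)
  have ni: "(\<lambda>t. \<bar>f t\<bar>) integrable_on {0..T}"
    using f by (simp add: absolutely_integrable_on_def)
  have "continuous_on {0..T} (\<lambda>t. X 0 + integral {0..t} f)"
    by (intro continuous_intros indefinite_integral_continuous_1 fi)
  then have cX: "continuous_on {0..T} X"
    using X continuous_on_eq by (metis (no_types, lifting))
  then have cXc: "continuous_on {0..T} (\<lambda>t. X t - c)"
    by (intro continuous_intros)
  show ai: "(\<lambda>t. (X t - c) * f t) absolutely_integrable_on {0..T}"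
    by (intro absolutely_integrable_bounded_measurable_product_real f
        continuous_imp_measurable_on_sets_lebesgue cXc compact_imp_bounded
        compact_continuous_image) auto
  define h where "h t = (X t - c) * f t" for t
  have hi: "h integrable_on {0..T}"
    using ai unfolding absolutely_integrable_on_def h_def by blast
  have sub: "g integrable_on {u..v}" and comb: "integral {0..v} g - integral {0..u} g = integral {u..v} g"
    if "g integrable_on {0..T}" "0 \<le> u" "u \<le> v" "v \<le> T" for g :: "real \<Rightarrow> real" and u v
  proof -
    show "g integrable_on {u..v}"
      using that by (intro integrable_on_subinterval[OF that(1)]) auto
    have "g integrable_on {0..v}"
      using that by (intro integrable_on_subinterval[OF that(1)]) auto
    from Henstock_Kurzweil_Integration.integral_combine[OF that(2,3) this]
    show "integral {0..v} g - integral {0..u} g = integral {u..v} g" by simp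
  qed
  define G where "G t = (X t - c)\<^sup>2 - 2 * integral {0..t} h" for t
  define m where "m t = integral {0..t} (\<lambda>s. \<bar>f s\<bar>)" for t
  have "G 0 = G T" using \<open>0 \<le> T\<close>
  proof (rule bounded_increments_imp_eq[where m=m])
    fix x e :: real assume x: "0 \<le> x" "x \<le> T" and "e > 0"
    \<comment> \<open>A quarter of \<open>e\<close> suffices since
      \<open>X v + X u - 2 * X s\<close> is made of four deviations from \<open>X x\<close>.\<close>
    then obtain d where "d > 0" and d: "\<And>y. y \<in> {0..T} \<Longrightarrow> \<bar>y - x\<bar> < d \<Longrightarrow> \<bar>X y - X x\<bar> < e / 4"
      using cX unfolding continuous_on_iff dist_real_def
      by (metis atLeastAtMost_iff divide_pos_pos zero_less_numeral)
    have "\<bar>G v - G u\<bar> \<le> e * (m v - m u)" if uv: "0 \<le> u" "u \<le> x" "x \<le> v" "v \<le> T" "v - u < d" for u v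
    proof -
      have 1: "X v - X u = integral {u..v} f"
        using X[of u] X[of v] comb[OF fi, of u v] uv by simp
      have fuv: "f integrable_on {u..v}" "h integrable_on {u..v}" "(\<lambda>s. \<bar>f s\<bar>) integrable_on {u..v}"
        using sub[OF fi] sub[OF hi] sub[OF ni] uv by simp_all
      \<comment> \<open>Factor the difference of squares and write \<open>X v - X u\<close> as the
        integral of \<open>f\<close>. Under one integral sign \<open>c\<close> cancels, and the
        remaining factor is small by continuity of \<open>X\<close>.\<close>
      have "G v - G u = (X v - X u) * (X v + X u - 2 * c) - 2 * integral {u..v} h"
        using comb[OF hi, of u v] uv by (simp add: G_def power2_eq_square algebra_simps)
      also have "\<dots> = integral {u..v} (\<lambda>s. f s * (X v + X u - 2 * c) - 2 * h s)"
        using fuv unfolding 1 by (subst integral_diff) (auto intro: integrable_on_mult_left)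
      also have "\<dots> = integral {u..v} (\<lambda>s. (X v + X u - 2 * X s) * f s)"
        by (intro integral_cong) (simp add: h_def algebra_simps)
      finally have 2: "G v - G u = integral {u..v} (\<lambda>s. (X v + X u - 2 * X s) * f s)" .
      have eq: "(\<lambda>s. (X v + X u - 2 * X s) * f s) = (\<lambda>s. f s * (X v + X u - 2 * c) - 2 * h s)"
        by (auto simp: h_def algebra_simps)
      have "\<bar>integral {u..v} (\<lambda>s. (X v + X u - 2 * X s) * f s)\<bar> \<le> integral {u..v} (\<lambda>s. e * \<bar>f s\<bar>)"
        unfolding real_norm_def[symmetric]
      proof (rule integral_norm_bound_integral)
        show "(\<lambda>s. (X v + X u - 2 * X s) * f s) integrable_on {u..v}"
          unfolding eq using fuv by (intro integrable_diff integrable_on_mult_left integrable_on_mult_right)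
        show "(\<lambda>s. e * norm (f s)) integrable_on {u..v}"
          using fuv by (simp add: integrable_on_mult_right)
        fix s assume "s \<in> {u..v}"
        then have "\<bar>X u - X x\<bar> < e / 4" "\<bar>X v - X x\<bar> < e / 4" "\<bar>X s - X x\<bar> < e / 4"
          using uv by (intro d; auto)+
        then have "\<bar>X v + X u - 2 * X s\<bar> \<le> e" by linarith
        then show "norm ((X v + X u - 2 * X s) * f s) \<le> e * norm (f s)"
          by (simp add: abs_mult mult_right_mono)
      qed
      also have "\<dots> = e * (m v - m u)"
        using comb[OF ni, of u v] uv by (simp add: m_def)
      finally show ?thesis using 2 by simp
    qed
    then show "\<exists>d>0. \<forall>u v. 0 \<le> u \<and> u \<le> x \<and> x \<le> v \<and> v \<le> T \<and> v - u < d \<longrightarrow> \<bar>G v - G u\<bar> \<le> e * (m v - m u)"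
      using \<open>d > 0\<close> by blast
  qed
  then show "integral {0..T} (\<lambda>t. (X t - c) * f t) = ((X T - c)\<^sup>2 - (X 0 - c)\<^sup>2) / 2"
    by (simp add: G_def flip: h_def)
qed

section \<open>Measurability and nonnegative integrals on the half-line\<close>

lemma borel_measurable_lebesgue_on_Ici:
  fixes f :: "real \<Rightarrow> real"
  assumes "\<And>n::nat. f \<in> borel_measurable (lebesgue_on {0..real n})"
  shows "f \<in> borel_measurable (lebesgue_on {0..})"
proof -
  have "(\<lambda>n. if t \<in> {0..real n} then f t else 0) \<longlonglongrightarrow> (if t \<in> {0..} then f t else 0)" for t
  proof (rule tendsto_eventually)
    obtain N where "t \<le> real N" using real_arch_simple by blast
    then show "\<forall>\<^sub>F n in sequentially. (if t \<in> {0..real n} then f t else 0) = (if t \<in> {0..} then f t else 0)"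
      by (intro eventually_sequentiallyI[of N]) auto
  qed
  then have "(\<lambda>t. if t \<in> {0..} then f t else 0) \<in> borel_measurable lebesgue"
    by (rule borel_measurable_LIMSEQ_real) (intro borel_measurable_if_I assms, auto)
  then show ?thesis by (rule borel_measurable_if_D)
qed

lemma nn_integral_lebesgue_on_Icc:
  fixes f :: "real \<Rightarrow> real"
  assumes "f integrable_on {a..b}" "\<And>t. t \<in> {a..b} \<Longrightarrow> 0 \<le> f t"
  shows "(\<integral>\<^sup>+ t. ennreal (f t) \<partial>lebesgue_on {a..b}) = ennreal (integral {a..b} f)"
  using nn_integral_has_integral_lebesgue'[of "{a..b}" f "integral {a..b} f"] assms
  by (simp add: nn_integral_restrict_space integrable_integral nn_integral_completion)

text \<open>Monotone convergence along growing intervals. Since \<open>ennreal\<close> clips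
  negative values to 0, the integrands increase with \<open>n\<close> for signed \<open>f\<close> as
  well.\<close>

lemma nn_integral_lebesgue_on_Ici_limit:
  fixes f :: "real \<Rightarrow> real"
  assumes "f \<in> borel_measurable (lebesgue_on {0..})"
  shows "(\<lambda>n. \<integral>\<^sup>+ t. ennreal (f t) \<partial>lebesgue_on {0..real n}) \<longlonglongrightarrow> (\<integral>\<^sup>+ t. ennreal (f t) \<partial>lebesgue_on {0..})"
proof -
  have m: "(\<lambda>t. ennreal (f t) * indicator {0..real n} t) \<in> borel_measurable lebesgue" for n
  proof -
    \<comment> \<open>Nothing is known about \<open>f\<close> on the negative half-line, so
      measurability is shown for its extension by zero; the indicator makes the two products
      equal.\<close>
    have "(\<lambda>t. ennreal (if t \<in> {0..} then f t else 0) * indicator {0..real n} t) \<in> borel_measurable lebesgue"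
      by (intro borel_measurable_times_ennreal borel_measurable_indicator
          measurable_compose[OF borel_measurable_if_I[OF assms] measurable_ennreal]) auto
    also have "(\<lambda>t. ennreal (if t \<in> {0..} then f t else 0) * indicator {0..real n} t) =
        (\<lambda>t. ennreal (f t) * indicator {0..real n} t)"
      by (auto simp: indicator_def)
    finally show ?thesis .
  qed
  have "(\<lambda>n. \<integral>\<^sup>+ t. ennreal (f t) * indicator {0..real n} t \<partial>lebesgue) \<longlonglongrightarrow>
      (\<integral>\<^sup>+ t. ennreal (f t) * indicator {0..} t \<partial>lebesgue)"
  proof (rule nn_integral_LIMSEQ)
    show "incseq (\<lambda>n t. ennreal (f t) * indicator {0..real n} t)"
      by (auto simp: incseq_def le_fun_def indicator_def)
    fix t
    obtain N where "t \<le> real N" using real_arch_simple by blast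
    then show "(\<lambda>n. ennreal (f t) * indicator {0..real n} t) \<longlonglongrightarrow> ennreal (f t) * indicator {0..} t"
      by (intro tendsto_eventually eventually_sequentiallyI[of N]) (auto simp: indicator_def)
  qed (rule m)
  then show ?thesis by (simp add: nn_integral_restrict_space)
qed

text \<open>The identity holds also when both sides are infinite: only the positive and negative parts of
  \<open>g\<close> are moved across the equation, so that nothing but finite terms is cancelled.\<close>

lemma nn_integral_dissipation:
  fixes r s g V :: "real \<Rightarrow> real"
  assumes r: "\<And>t. 0 \<le> t \<Longrightarrow> 0 \<le> r t" and s: "\<And>t. 0 \<le> t \<Longrightarrow> 0 \<le> s t"
    and rs: "\<And>t. 0 \<le> t \<Longrightarrow> r t = s t - g t"
    and g: "\<And>T. 0 \<le> T \<Longrightarrow> g absolutely_integrable_on {0..T}"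
    and V: "\<And>T. 0 \<le> T \<Longrightarrow> integral {0..T} g = V T - V 0" "\<And>T. 0 \<le> T \<Longrightarrow> 0 \<le> V T"
    and ms: "s \<in> borel_measurable (lebesgue_on {0..})"
    and lim: "(V \<longlongrightarrow> 0) at_top"
  shows "(\<integral>\<^sup>+ t. ennreal (r t) \<partial>lebesgue_on {0..}) = (\<integral>\<^sup>+ t. ennreal (s t) \<partial>lebesgue_on {0..}) + ennreal (V 0)"
proof -
  have mg: "g \<in> borel_measurable (lebesgue_on {0..})"
    using g by (intro borel_measurable_lebesgue_on_Ici) (simp add: absolutely_integrable_measurable)
  have "(\<lambda>t. s t - g t) \<in> borel_measurable (lebesgue_on {0..})"
    using ms mg by (rule borel_measurable_diff)
  then have mr: "r \<in> borel_measurable (lebesgue_on {0..})"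
    by (rule measurable_cong[THEN iffD1, rotated]) (simp add: rs)
  have eq: "(\<integral>\<^sup>+ t. ennreal (r t) \<partial>lebesgue_on {0..real n}) + ennreal (V (real n)) =
      (\<integral>\<^sup>+ t. ennreal (s t) \<partial>lebesgue_on {0..real n}) + ennreal (V 0)" for n
  proof -
    let ?I = "{0..real n}" let ?N = "\<lambda>f. \<integral>\<^sup>+ t. ennreal (f t) \<partial>lebesgue_on {0..real n}"
    \<comment> \<open>Both parts of \<open>g\<close> have finite integrals on this bounded interval,
      whereas those of \<open>r\<close> and \<open>s\<close> may be infinite even here.\<close>
    define gp gm where "gp t = max 0 (g t)" and "gm t = max 0 (- g t)" for t
    have gn: "g absolutely_integrable_on ?I" using g by simp
    have gpi: "gp absolutely_integrable_on ?I" unfolding gp_def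
      using gn by (intro absolutely_integrable_max_1) auto
    have gmi: "gm absolutely_integrable_on ?I" unfolding gm_def
      using gn by (intro absolutely_integrable_max_1) (auto simp: absolutely_integrable_on_def integrable_neg)
    have meas: "f \<in> borel_measurable (lebesgue_on ?I)" if "f \<in> borel_measurable (lebesgue_on {0..})" for f :: "real \<Rightarrow> real"
      using that by (rule measurable_restrict_mono) auto
    have mgp: "gp \<in> borel_measurable (lebesgue_on ?I)" "gm \<in> borel_measurable (lebesgue_on ?I)"
      using gpi gmi by (simp_all add: absolutely_integrable_measurable)
    have n: "?N gp = ennreal (integral ?I gp)" "?N gm = ennreal (integral ?I gm)"
      using gpi gmi by (intro nn_integral_lebesgue_on_Icc; simp add: absolutely_integrable_on_def gp_def gm_def)+
    have nn: "integral ?I gp \<ge> 0" "integral ?I gm \<ge> 0"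
      using gpi gmi by (intro integral_nonneg; simp add: absolutely_integrable_on_def gp_def gm_def)+
    have "integral ?I gp - integral ?I gm = integral ?I (\<lambda>t. gp t - gm t)"
      using gpi gmi by (intro integral_diff[symmetric]) (simp_all add: absolutely_integrable_on_def)
    also have "\<dots> = V (real n) - V 0"
      using V(1)[of "real n"] by (simp add: gp_def gm_def max_def cong: if_cong) (smt (verit) integral_cong)
    finally have d: "integral ?I gp + V 0 = V (real n) + integral ?I gm" by simp
    have "?N r + ?N gp = (\<integral>\<^sup>+ t. ennreal (r t) + ennreal (gp t) \<partial>lebesgue_on ?I)"
      using meas[OF mr] mgp
      by (intro nn_integral_add[symmetric] measurable_compose[OF _ measurable_ennreal])
    also have "\<dots> = (\<integral>\<^sup>+ t. ennreal (s t) + ennreal (gm t) \<partial>lebesgue_on ?I)"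
    proof (rule nn_integral_cong)
      fix t assume "t \<in> space (lebesgue_on ?I)"
      then have "0 \<le> t" by simp
      then show "ennreal (r t) + ennreal (gp t) = ennreal (s t) + ennreal (gm t)"
        using r[of t] s[of t] rs[of t]
        by (auto simp: gp_def gm_def max_def simp flip: ennreal_plus)
    qed
    also have "\<dots> = ?N s + ?N gm"
      using meas[OF ms] mgp by (intro nn_integral_add measurable_compose[OF _ measurable_ennreal])
    finally have 1: "?N r + ?N gp = ?N s + ?N gm" .
    have dd: "ennreal (integral ?I gp) + ennreal (V 0) = ennreal (V (real n)) + ennreal (integral ?I gm)"
      using nn V(2) d by (simp flip: ennreal_plus)
    have "(?N gp + ?N gm) + (?N r + ennreal (V (real n))) = (?N r + ?N gp) + (ennreal (V (real n)) + ?N gm)"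
      by (simp add: ac_simps)
    also have "\<dots> = (?N s + ?N gm) + (?N gp + ennreal (V 0))"
      unfolding 1 unfolding n dd ..
    also have "\<dots> = (?N gp + ?N gm) + (?N s + ennreal (V 0))"
      by (simp add: ac_simps)
    finally show ?thesis
      unfolding n by (simp add: ennreal_add_left_cancel)
  qed
  \<comment> \<open>In the limit the terminal value of \<open>V\<close> disappears and only the
    initial one remains.\<close>
  have limn: "(\<lambda>n. V (real n)) \<longlonglongrightarrow> 0"
    using lim filterlim_real_sequentially by (rule filterlim_compose)
  have "(\<lambda>n. (\<integral>\<^sup>+ t. ennreal (r t) \<partial>lebesgue_on {0..real n}) + ennreal (V (real n))) \<longlonglongrightarrow>
      (\<integral>\<^sup>+ t. ennreal (r t) \<partial>lebesgue_on {0..}) + ennreal 0"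
    by (intro tendsto_add nn_integral_lebesgue_on_Ici_limit mr tendsto_ennrealI limn)
  moreover have "(\<lambda>n. (\<integral>\<^sup>+ t. ennreal (s t) \<partial>lebesgue_on {0..real n}) + ennreal (V 0)) \<longlonglongrightarrow>
      (\<integral>\<^sup>+ t. ennreal (s t) \<partial>lebesgue_on {0..}) + ennreal (V 0)"
    by (intro tendsto_add nn_integral_lebesgue_on_Ici_limit ms tendsto_const)
  ultimately show ?thesis unfolding eq using LIMSEQ_unique by fastforce
qed

text \<open>The ray on which the bound holds contains intervals of every length \<open>n\<close>,
  hence has infinite measure.\<close>

lemma nn_integral_lebesgue_on_Ici_infinite:
  assumes "c > 0" and "\<forall>\<^sub>F t in at_top. c \<le> r t"
  shows "(\<integral>\<^sup>+ t. ennreal (r t) \<partial>lebesgue_on {0::real..}) = \<infinity>"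
proof -
  obtain T where T: "\<And>t. T \<le> t \<Longrightarrow> c \<le> r t"
    using assms(2) by (auto simp: eventually_at_top_linorder)
  have e: "emeasure lebesgue {max 0 T..} = (\<infinity>::ennreal)"
  proof -
    have "ennreal (real n) \<le> emeasure lebesgue {max 0 T..}" for n
    proof -
      have "emeasure lebesgue {max 0 T..max 0 T + real n} \<le> emeasure lebesgue {max 0 T..}"
        by (intro emeasure_mono) auto
      then show ?thesis by simp
    qed
    then show ?thesis
      by (metis ennreal_Ex_less_of_nat ennreal_of_nat_eq_real_of_nat infinity_ennreal_def
          leD top.not_eq_extremum)
  qed
  have "ennreal c * emeasure lebesgue {max 0 T..} = (\<integral>\<^sup>+ t. ennreal c * indicator {max 0 T..} t \<partial>lebesgue)"
    by (simp add: nn_integral_cmult_indicator)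
  also have "\<dots> \<le> (\<integral>\<^sup>+ t. ennreal (r t) * indicator {0..} t \<partial>lebesgue)"
    by (intro nn_integral_mono) (auto simp: indicator_def T ennreal_leI)
  finally show ?thesis
    using e assms(1) by (simp add: nn_integral_restrict_space ennreal_mult_top top.extremum_unique)
qed

section \<open>Lyapunov function and running cost\<close>

text \<open>The reference point puts all of \<open>\<theta>s\<close> and \<open>ls\<close> into
  component 1, the only one without an input. Dividing by the gains cancels the factors
  \<open>gb\<close> and \<open>gbh\<close> in \<open>vfield\<close>.\<close>

definition lyapunov ::
  "('v, 'e) network \<Rightarrow> ('v \<Rightarrow> real) \<Rightarrow> ('e \<Rightarrow> real) \<Rightarrow> ('v, 'e) state \<Rightarrow> real" where
  "lyapunov S \<theta>s ls x =
     (\<Sum>i\<in>nodes S. \<Sum>k=1..rho S i. (fst x i k - (if k = 1 then \<theta>s i else 0))\<^sup>2 / (2 * gb S i k)) +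
     (\<Sum>j\<in>edges S. \<Sum>k=1..rhoh S j. (snd x j k - (if k = 1 then ls j else 0))\<^sup>2 / (2 * gbh S j k))"

text \<open>Formal derivative of \<open>lyapunov\<close> along \<open>vfield\<close>, written
  pointwise because a trajectory need only satisfy its differential equation almost
  everywhere.\<close>

definition lyapunov_rate ::
  "('v, 'e) network \<Rightarrow> ('v \<Rightarrow> real) \<Rightarrow> ('e \<Rightarrow> real) \<Rightarrow> ('v, 'e) state \<Rightarrow> ('v, 'e) input \<Rightarrow> real" where
  "lyapunov_rate S \<theta>s ls x w =
     (\<Sum>i\<in>nodes S. \<Sum>k=1..rho S i.
        (fst x i k - (if k = 1 then \<theta>s i else 0)) * fst (vfield S x w) i k / gb S i k) +
     (\<Sum>j\<in>edges S. \<Sum>k=1..rhoh S j.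
        (snd x j k - (if k = 1 then ls j else 0)) * snd (vfield S x w) j k / gbh S j k)"

definition excess_input :: "('v, 'e) network \<Rightarrow> ('v, 'e) state \<Rightarrow> ('v, 'e) input \<Rightarrow> ('v, 'e) input" where
  "excess_input S x w =
     ((\<lambda>i k. fst w i k - fst (apd_feedback S x) i k), (\<lambda>j k. snd w j k - snd (apd_feedback S x) j k))"

lemma sum_from_1:
  fixes f :: "nat \<Rightarrow> real"
  assumes "1 \<le> n"
  shows "(\<Sum>k=1..n. f k) = f 1 + (\<Sum>k=2..n. f k)"
  using assms by (simp add: sum.atLeast_Suc_atMost numeral_2_eq_2)

lemma proj_scale: "b > 0 \<Longrightarrow> proj (b * s) e = b * proj s e"
  by (auto simp: proj_def zero_le_mult_iff)

text \<open>For nonnegative \<open>e\<close> the projection changes \<open>s\<close> only at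
  \<open>e = 0\<close>, where both sides vanish. This removes the projection from the auxiliary
  terms of \<open>lyapunov_rate\<close>.\<close>

lemma proj_mult_self: "0 \<le> e \<Longrightarrow> e * proj s e = e * s"
  by (auto simp: proj_def)

lemma valid_networkD:
  assumes "valid_network S"
  shows "finite (nodes S)" "finite (edges S)"
    and "\<And>i. i \<in> nodes S \<Longrightarrow> convex_C1_loc_lipschitz (objF S i)"
    and "\<And>j. j \<in> edges S \<Longrightarrow> convex_C1_loc_lipschitz (conH S j)"
    and "\<And>i. i \<in> nodes S \<Longrightarrow> 1 \<le> rho S i" "\<And>j. j \<in> edges S \<Longrightarrow> 1 \<le> rhoh S j"
    and "\<And>i k. \<lbrakk>i \<in> nodes S; k \<in> {1..rho S i}\<rbrakk> \<Longrightarrow> 0 < gb S i k"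
    and "\<And>j k. \<lbrakk>j \<in> edges S; k \<in> {1..rhoh S j}\<rbrakk> \<Longrightarrow> 0 < gbh S j k"
    and "\<And>i k. \<lbrakk>i \<in> nodes S; k \<in> {2..rho S i}\<rbrakk> \<Longrightarrow> 0 < ga S i k"
    and "\<And>j k. \<lbrakk>j \<in> edges S; k \<in> {2..rhoh S j}\<rbrakk> \<Longrightarrow> 0 < gah S j k"
  using assms unfolding valid_network_def by simp_all

lemma input_normsq_nonneg:
  assumes "valid_network S"
  shows "0 \<le> input_normsq S w"
  unfolding input_normsq_def
  by (intro add_nonneg_nonneg sum_nonneg mult_nonneg_nonneg divide_nonneg_nonneg)
     (auto intro!: less_imp_le valid_networkD[OF assms])

text \<open>All weights are positive, so every summand must vanish. Applied to the excess input, it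
  identifies a control of least cost with the feedback.\<close>

lemma input_normsq_eq_0D:
  assumes "valid_network S" "input_normsq S w = 0"
  shows "input_eq S w (\<lambda>_ _. 0, \<lambda>_ _. 0)"
proof -
  let ?f = "\<lambda>i. \<Sum>k=2..rho S i. 1 / 2 * (1 / (ga S i k * gb S i k)) * (fst w i k)\<^sup>2"
  let ?g = "\<lambda>j. \<Sum>k=2..rhoh S j. 1 / 2 * (1 / (gah S j k * gbh S j k)) * (snd w j k)\<^sup>2"
  note v = valid_networkD[OF assms(1)]
  have pos: "0 < 1 / 2 * (1 / (ga S i k * gb S i k))" if "i \<in> nodes S" "k \<in> {2..rho S i}" for i k
    using v(7)[of i k] v(9)[of i k] that by simp
  have posh: "0 < 1 / 2 * (1 / (gah S j k * gbh S j k))" if "j \<in> edges S" "k \<in> {2..rhoh S j}" for j k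
    using v(8)[of j k] v(10)[of j k] that by simp
  have tn: "0 \<le> 1 / 2 * (1 / (ga S i k * gb S i k)) * (fst w i k)\<^sup>2" if "i \<in> nodes S" "k \<in> {2..rho S i}" for i k
    using pos[OF that] by (intro mult_nonneg_nonneg) auto
  have tnh: "0 \<le> 1 / 2 * (1 / (gah S j k * gbh S j k)) * (snd w j k)\<^sup>2" if "j \<in> edges S" "k \<in> {2..rhoh S j}" for j k
    using posh[OF that] by (intro mult_nonneg_nonneg) auto
  have fn: "0 \<le> ?f i" if "i \<in> nodes S" for i
    by (intro sum_nonneg tn that)
  have gn: "0 \<le> ?g j" if "j \<in> edges S" for j
    by (intro sum_nonneg tnh that)
  have "0 \<le> sum ?f (nodes S)" "0 \<le> sum ?g (edges S)"
    by (rule sum_nonneg, erule fn) (rule sum_nonneg, erule gn)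
  then have z: "sum ?f (nodes S) = 0" "sum ?g (edges S) = 0"
    using assms(2) unfolding input_normsq_def by linarith+
  have "fst w i k = 0" if "i \<in> nodes S" "k \<in> {2..rho S i}" for i k
    using sum_nonneg_0[OF finite_atLeastAtMost tn[OF that(1)] sum_nonneg_0[OF v(1) fn z(1) that(1)] that(2)]
      pos[OF that] by auto
  moreover have "snd w j k = 0" if "j \<in> edges S" "k \<in> {2..rhoh S j}" for j k
    using sum_nonneg_0[OF finite_atLeastAtMost tnh[OF that(1)] sum_nonneg_0[OF v(2) gn z(2) that(1)] that(2)]
      posh[OF that] by auto
  ultimately show ?thesis by (simp add: input_eq_def)
qed

text \<open>\<open>eta\<close> applies the transpose of \<open>matR\<close>, and moving that
  transpose to the other factor turns differences of \<open>\<theta>\<close> into differences of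
  \<open>omega\<close>. The coupling cost of the nodes is thereby distributed over the
  edges.\<close>

lemma sum_theta_mult_eta_diff:
  "(\<Sum>i\<in>nodes S. (\<theta> i - \<theta>s i) * (eta S \<theta> l i - eta S \<theta>s ls i)) =
   (\<Sum>j\<in>edges S. (omega S \<theta> j - omega S \<theta>s j) *
      (deriv (conH S j) (omega S \<theta> j) * l j - deriv (conH S j) (omega S \<theta>s j) * ls j))"
  (is "_ = (\<Sum>j\<in>_. _ * ?d j)")
proof -
  have "(\<Sum>i\<in>nodes S. (\<theta> i - \<theta>s i) * (eta S \<theta> l i - eta S \<theta>s ls i)) =
      (\<Sum>i\<in>nodes S. \<Sum>j\<in>edges S. (matR S j i * \<theta> i - matR S j i * \<theta>s i) * ?d j)"
    unfolding eta_def sum_subtractf[symmetric] sum_distrib_left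
    by (intro sum.cong refl) (simp add: algebra_simps)
  also have "\<dots> = (\<Sum>j\<in>edges S. \<Sum>i\<in>nodes S. (matR S j i * \<theta> i - matR S j i * \<theta>s i) * ?d j)"
    by (rule sum.swap)
  also have "\<dots> = (\<Sum>j\<in>edges S. (omega S \<theta> j - omega S \<theta>s j) * ?d j)"
    unfolding omega_def sum_subtractf[symmetric] sum_distrib_right ..
  finally show ?thesis .
qed

text \<open>The input norm is dropped, and the cross terms are nonnegative: monotone derivatives
  handle the objective, while the coupling, moved to the edges, is controlled by convexity of the
  constraints and the KKT conditions.\<close>

lemma running_cost_lower_bound:
  assumes "valid_network S" "optimal_solution S \<theta>s ls" "tau_nonneg S x"
  shows "(\<Sum>i\<in>nodes S. \<Sum>k=2..rho S i. ga S i k / (2 * gb S i k) * (fst x i k)\<^sup>2) +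
    (\<Sum>j\<in>edges S. \<Sum>k=2..rhoh S j. gah S j k / (2 * gbh S j k) * (snd x j k)\<^sup>2)
    \<le> running_cost S \<theta>s ls x w"
proof -
  note v = valid_networkD[OF assms(1)]
  define th where "th = theta S x"
  define l where "l = lam S x"
  define om where "om = omega S th"
  define oms where "oms = omega S \<theta>s"
  let ?D = "\<lambda>j. deriv (conH S j)"
  \<comment> \<open>\<open>?E j\<close> is the share of edge \<open>j\<close> in the coupling term,
    and \<open>?P j\<close> is \<open>qedge\<close> without its quadratic part. Only their sum is
    shown to be nonnegative.\<close>
  let ?E = "\<lambda>j. (om j - oms j) * (?D j (om j) * l j - ?D j (oms j) * ls j)"
  let ?P = "\<lambda>j. - (snd x j 1 - ls j) * proj (conH S j (om j)) (snd x j 1)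
     - (\<Sum>k=2..rhoh S j. snd x j k * conH S j (om j))"
  have node: "0 \<le> (\<Sum>i\<in>nodes S. (th i - \<theta>s i) * (deriv (objF S i) (th i) - deriv (objF S i) (\<theta>s i)))"
    by (intro sum_nonneg convex_C1_deriv_mono v)
  have edge: "0 \<le> ?E j + ?P j" if j: "j \<in> edges S" for j
  proof -
    let ?h = "conH S j (om j)" and ?hs = "conH S j (oms j)"
    have ls: "ls j * ?hs = 0" "0 \<le> ls j" "?hs \<le> 0"
      using assms(2) j by (auto simp: optimal_solution_def oms_def)
    have tau: "0 \<le> snd x j k" if "k \<in> {1..rhoh S j}" for k
      using assms(3) j that by (auto simp: tau_nonneg_def)
    then have l: "0 \<le> l j" by (auto simp: l_def lam_def intro: sum_nonneg)
    have l_eq: "l j = snd x j 1 + (\<Sum>k=2..rhoh S j. snd x j k)"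
      unfolding l_def lam_def by (rule sum_from_1) (rule v(6)[OF j])
    \<comment> \<open>Each of the two tangent inequalities is weighted by the nonnegative multiplier
      belonging to its point of tangency.\<close>
    have 1: "(?hs - ?h) * l j \<ge> ?D j (om j) * (oms j - om j) * l j"
      using convex_C1_above_tangent[OF v(4)[OF j], of "om j" "oms j"] l by (intro mult_right_mono) auto
    have 2: "(?h - ?hs) * ls j \<ge> ?D j (oms j) * (om j - oms j) * ls j"
      using convex_C1_above_tangent[OF v(4)[OF j], of "oms j" "om j"] ls by (intro mult_right_mono) auto
    have "?E j \<ge> (?h - ?hs) * (l j - ls j)"
      using 1 2 by (simp add: algebra_simps)
    \<comment> \<open>Feasibility and complementary slackness remove \<open>?hs\<close> from the
      bound.\<close>
    moreover have "l j * ?hs \<le> 0" using l ls by (simp add: mult_nonneg_nonpos)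
    ultimately have E: "?E j \<ge> ?h * (l j - ls j)"
      using ls by (simp add: algebra_simps)
    \<comment> \<open>The projection matters only if the first component is 0 and
      \<open>?h < 0\<close>; then the left side is 0 and the right side is
      \<open>- ls j * ?h\<close>, which is nonnegative.\<close>
    have "(snd x j 1 - ls j) * proj ?h (snd x j 1) \<le> (snd x j 1 - ls j) * ?h"
      using tau[of 1] v(6)[OF j] ls by (auto simp: proj_def mult_le_0_iff)
    moreover have "(\<Sum>k=2..rhoh S j. snd x j k * ?h) = (l j - snd x j 1) * ?h"
      by (simp add: l_eq sum_distrib_right)
    ultimately have "?P j \<ge> - ?h * (l j - ls j)"
      by (simp add: algebra_simps)
    with E show ?thesis by linarith
  qed
  have "0 \<le> (\<Sum>j\<in>edges S. ?E j + ?P j)" by (intro sum_nonneg edge)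
  also have "\<dots> = (\<Sum>i\<in>nodes S. (th i - \<theta>s i) * (eta S th l i - eta S \<theta>s ls i)) + sum ?P (edges S)"
    unfolding sum_theta_mult_eta_diff om_def oms_def by (rule sum.distrib)
  finally have "0 \<le> (\<Sum>i\<in>nodes S. (th i - \<theta>s i) *
      (deriv (objF S i) (th i) - deriv (objF S i) (\<theta>s i) + eta S th l i - eta S \<theta>s ls i)) + sum ?P (edges S)"
    using node by (simp only: add_diff_eq[symmetric] distrib_left sum.distrib)
  then show ?thesis
    using input_normsq_nonneg[OF assms(1), of w]
    unfolding running_cost_def qnode_def qedge_def th_def l_def om_def sum.distrib by linarith
qed

text \<open>The state costs are designed for this identity: their cross terms reproduce the gradient
  part of \<open>lyapunov_rate\<close>, and their quadratic terms complete the squares of the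
  inputs. It is pointwise in state and input and involves no trajectory.\<close>

lemma running_cost_eq_excess_minus_rate:
  assumes "valid_network S" "optimal_solution S \<theta>s ls" "tau_nonneg S x"
  shows "running_cost S \<theta>s ls x w = input_normsq S (excess_input S x w) - lyapunov_rate S \<theta>s ls x w"
proof -
  note v = valid_networkD[OF assms(1)]
  let ?ph = "phi S (theta S x) (lam S x)"
  \<comment> \<open>Here \<open>u\<close> is an input and \<open>y\<close> its state component:
    \<open>u + a * y\<close> is the deviation from the feedback \<open>- a * y\<close>, and
    \<open>y * u / b\<close> is the input's share of \<open>lyapunov_rate\<close>.\<close>
  have sq: "1 / 2 * (1 / (a * b)) * u\<^sup>2 + a / (2 * b) * y\<^sup>2 =
      1 / 2 * (1 / (a * b)) * (u + a * y)\<^sup>2 - y * u / b" if "a > 0" "b > 0" for a b u y :: real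
    using that by (simp add: field_simps power2_eq_square)
  have node: "qnode S \<theta>s ls x i + (\<Sum>k=2..rho S i. 1 / 2 * (1 / (ga S i k * gb S i k)) * (fst w i k)\<^sup>2) =
      (\<Sum>k=2..rho S i. 1 / 2 * (1 / (ga S i k * gb S i k)) * (fst (excess_input S x w) i k)\<^sup>2) -
      (\<Sum>k=1..rho S i. (fst x i k - (if k = 1 then \<theta>s i else 0)) * fst (vfield S x w) i k / gb S i k)"
    if i: "i \<in> nodes S" for i
  proof -
    have th: "theta S x i = fst x i 1 + (\<Sum>k=2..rho S i. fst x i k)"
      unfolding theta_def by (rule sum_from_1) (rule v(5)[OF i])
    \<comment> \<open>By stationarity the starred terms cancel, so the bracket in
      \<open>qnode\<close> is \<open>- ?ph i\<close>.\<close>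
    have q: "qnode S \<theta>s ls x i =
        - ((theta S x i - \<theta>s i) * ?ph i) + (\<Sum>k=2..rho S i. ga S i k / (2 * gb S i k) * (fst x i k)\<^sup>2)"
      using assms(2) i by (simp add: qnode_def phi_def optimal_solution_def algebra_simps eq_neg_iff_add_eq_0)
    have r: "(\<Sum>k=1..rho S i. (fst x i k - (if k = 1 then \<theta>s i else 0)) * fst (vfield S x w) i k / gb S i k) =
        (fst x i 1 - \<theta>s i) * ?ph i + (\<Sum>k=2..rho S i. fst x i k * ?ph i + fst x i k * fst w i k / gb S i k)"
    proof (subst sum_from_1[OF v(5)[OF i]], rule arg_cong2[where f="(+)"])
      show "(fst x i 1 - (if 1 = (1::nat) then \<theta>s i else 0)) * fst (vfield S x w) i 1 / gb S i 1 =
          (fst x i 1 - \<theta>s i) * ?ph i"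
        using v(5)[OF i] v(7)[OF i, of 1] by (simp add: vfield_def Io_def)
      show "(\<Sum>k=2..rho S i. (fst x i k - (if k = 1 then \<theta>s i else 0)) * fst (vfield S x w) i k / gb S i k) =
          (\<Sum>k=2..rho S i. fst x i k * ?ph i + fst x i k * fst w i k / gb S i k)"
      proof (rule sum.cong)
        fix k assume k: "k \<in> {2..rho S i}"
        then have "gb S i k > 0" using v(7)[OF i, of k] by simp
        then show "(fst x i k - (if k = 1 then \<theta>s i else 0)) * fst (vfield S x w) i k / gb S i k =
            fst x i k * ?ph i + fst x i k * fst w i k / gb S i k"
          using k by (simp add: vfield_def Io_def field_simps)
      qed simp
    qed
    have s: "(\<Sum>k=2..rho S i. 1 / 2 * (1 / (ga S i k * gb S i k)) * (fst w i k)\<^sup>2) +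
        (\<Sum>k=2..rho S i. ga S i k / (2 * gb S i k) * (fst x i k)\<^sup>2) =
        (\<Sum>k=2..rho S i. 1 / 2 * (1 / (ga S i k * gb S i k)) * (fst (excess_input S x w) i k)\<^sup>2) -
        (\<Sum>k=2..rho S i. fst x i k * fst w i k / gb S i k)"
      unfolding sum.distrib[symmetric] sum_subtractf[symmetric]
    proof (rule sum.cong)
      fix k assume k: "k \<in> {2..rho S i}"
      show "1 / 2 * (1 / (ga S i k * gb S i k)) * (fst w i k)\<^sup>2 + ga S i k / (2 * gb S i k) * (fst x i k)\<^sup>2 =
          1 / 2 * (1 / (ga S i k * gb S i k)) * (fst (excess_input S x w) i k)\<^sup>2 - fst x i k * fst w i k / gb S i k"
        using sq[OF v(9)[OF i k] v(7)[OF i, of k]] k by (simp add: excess_input_def apd_feedback_def)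
    qed simp
    have "(\<Sum>k=2..rho S i. fst x i k * ?ph i) = (theta S x i - fst x i 1) * ?ph i"
      by (simp add: th sum_distrib_right)
    then have "(theta S x i - \<theta>s i) * ?ph i =
        (fst x i 1 - \<theta>s i) * ?ph i + (\<Sum>k=2..rho S i. fst x i k * ?ph i)"
      by (simp add: algebra_simps)
    then show ?thesis
      using s unfolding q r sum.distrib by linarith
  qed
  have edge: "qedge S ls x j + (\<Sum>k=2..rhoh S j. 1 / 2 * (1 / (gah S j k * gbh S j k)) * (snd w j k)\<^sup>2) =
      (\<Sum>k=2..rhoh S j. 1 / 2 * (1 / (gah S j k * gbh S j k)) * (snd (excess_input S x w) j k)\<^sup>2) -
      (\<Sum>k=1..rhoh S j. (snd x j k - (if k = 1 then ls j else 0)) * snd (vfield S x w) j k / gbh S j k)"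
    if j: "j \<in> edges S" for j
  proof -
    let ?h = "conH S j (omega S (theta S x) j)"
    have tau: "0 \<le> snd x j k" if "k \<in> {1..rhoh S j}" for k
      using assms(3) j that by (auto simp: tau_nonneg_def)
    have r: "(\<Sum>k=1..rhoh S j. (snd x j k - (if k = 1 then ls j else 0)) * snd (vfield S x w) j k / gbh S j k) =
        (snd x j 1 - ls j) * proj ?h (snd x j 1) +
        (\<Sum>k=2..rhoh S j. snd x j k * ?h + snd x j k * snd w j k / gbh S j k)"
    \<comment> \<open>Component 1 is treated apart: it has the reference value \<open>ls j\<close>
      and no input, and its projection survives as the one in \<open>qedge\<close>. For the other
      components the factor \<open>snd x j k\<close> absorbs the projection.\<close>
    proof (subst sum_from_1[OF v(6)[OF j]], rule arg_cong2[where f="(+)"])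
      show "(snd x j 1 - (if 1 = (1::nat) then ls j else 0)) * snd (vfield S x w) j 1 / gbh S j 1 =
          (snd x j 1 - ls j) * proj ?h (snd x j 1)"
        using v(6)[OF j] v(8)[OF j, of 1] by (simp add: vfield_def Io_def proj_scale)
      show "(\<Sum>k=2..rhoh S j. (snd x j k - (if k = 1 then ls j else 0)) * snd (vfield S x w) j k / gbh S j k) =
          (\<Sum>k=2..rhoh S j. snd x j k * ?h + snd x j k * snd w j k / gbh S j k)"
      proof (rule sum.cong)
        fix k assume k: "k \<in> {2..rhoh S j}"
        then have "gbh S j k > 0" using v(8)[OF j, of k] by simp
        then show "(snd x j k - (if k = 1 then ls j else 0)) * snd (vfield S x w) j k / gbh S j k =
            snd x j k * ?h + snd x j k * snd w j k / gbh S j k"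
          using k tau[of k] by (simp add: vfield_def Io_def proj_mult_self) (simp add: field_simps)
      qed simp
    qed
    have s: "(\<Sum>k=2..rhoh S j. 1 / 2 * (1 / (gah S j k * gbh S j k)) * (snd w j k)\<^sup>2) +
        (\<Sum>k=2..rhoh S j. gah S j k / (2 * gbh S j k) * (snd x j k)\<^sup>2) =
        (\<Sum>k=2..rhoh S j. 1 / 2 * (1 / (gah S j k * gbh S j k)) * (snd (excess_input S x w) j k)\<^sup>2) -
        (\<Sum>k=2..rhoh S j. snd x j k * snd w j k / gbh S j k)"
      unfolding sum.distrib[symmetric] sum_subtractf[symmetric]
    proof (rule sum.cong)
      fix k assume k: "k \<in> {2..rhoh S j}"
      show "1 / 2 * (1 / (gah S j k * gbh S j k)) * (snd w j k)\<^sup>2 + gah S j k / (2 * gbh S j k) * (snd x j k)\<^sup>2 =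
          1 / 2 * (1 / (gah S j k * gbh S j k)) * (snd (excess_input S x w) j k)\<^sup>2 - snd x j k * snd w j k / gbh S j k"
        using sq[OF v(10)[OF j k] v(8)[OF j, of k]] k by (simp add: excess_input_def apd_feedback_def)
    qed simp
    show ?thesis
      using s unfolding qedge_def r sum.distrib mult_minus_left by linarith
  qed
  have "(\<Sum>i\<in>nodes S. qnode S \<theta>s ls x i) + (\<Sum>j\<in>edges S. qedge S ls x j) + input_normsq S w =
    (\<Sum>i\<in>nodes S. qnode S \<theta>s ls x i + (\<Sum>k=2..rho S i. 1 / 2 * (1 / (ga S i k * gb S i k)) * (fst w i k)\<^sup>2)) +
    (\<Sum>j\<in>edges S. qedge S ls x j + (\<Sum>k=2..rhoh S j. 1 / 2 * (1 / (gah S j k * gbh S j k)) * (snd w j k)\<^sup>2))"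
    unfolding input_normsq_def sum.distrib by linarith
  also have "\<dots> = input_normsq S (excess_input S x w) - lyapunov_rate S \<theta>s ls x w"
    unfolding input_normsq_def lyapunov_rate_def
    by (simp only: node edge sum_subtractf cong: sum.cong)
  finally show ?thesis unfolding running_cost_def by linarith
qed

section \<open>Total cost of stabilizing controls\<close>

definition auxiliary_zero :: "('v, 'e) network \<Rightarrow> ('v, 'e) state \<Rightarrow> bool" where
  "auxiliary_zero S x \<longleftrightarrow>
     (\<forall>i\<in>nodes S. \<forall>k\<in>{2..rho S i}. fst x i k = 0) \<and> (\<forall>j\<in>edges S. \<forall>k\<in>{2..rhoh S j}. snd x j k = 0)"

lemma lyapunov_nonneg:
  assumes "valid_network S"
  shows "0 \<le> lyapunov S \<theta>s ls x"
  unfolding lyapunov_def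
  by (intro add_nonneg_nonneg sum_nonneg divide_nonneg_nonneg mult_nonneg_nonneg)
     (auto intro!: less_imp_le valid_networkD[OF assms])

lemma lyapunov_cong:
  assumes "state_eq S x y"
  shows "lyapunov S \<theta>s ls x = lyapunov S \<theta>s ls y"
  using assms by (simp add: lyapunov_def state_eq_def)

text \<open>An output is the sum of all components, so with vanishing auxiliary ones it equals
  component 1, and the state is the reference point.\<close>

lemma lyapunov_eq_0:
  assumes "valid_network S" "outputs_at S x \<theta>s ls" "auxiliary_zero S x"
  shows "lyapunov S \<theta>s ls x = 0"
proof -
  note v = valid_networkD[OF assms(1)]
  have "fst x i k = (if k = 1 then \<theta>s i else 0)" if "i \<in> nodes S" "k \<in> {1..rho S i}" for i k
  proof -
    have "\<theta>s i = fst x i 1 + (\<Sum>k=2..rho S i. fst x i k)"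
      using assms(2) that(1) sum_from_1[OF v(5)[OF that(1)], of "fst x i"]
      by (simp add: outputs_at_def theta_def)
    also have "(\<Sum>k=2..rho S i. fst x i k) = 0"
      using assms(3) that(1) by (intro sum.neutral) (auto simp: auxiliary_zero_def)
    finally show ?thesis using assms(3) that by (auto simp: auxiliary_zero_def)
  qed
  moreover have "snd x j k = (if k = 1 then ls j else 0)" if "j \<in> edges S" "k \<in> {1..rhoh S j}" for j k
  proof -
    have "ls j = snd x j 1 + (\<Sum>k=2..rhoh S j. snd x j k)"
      using assms(2) that(1) sum_from_1[OF v(6)[OF that(1)], of "snd x j"]
      by (simp add: outputs_at_def lam_def)
    also have "(\<Sum>k=2..rhoh S j. snd x j k) = 0"
      using assms(3) that(1) by (intro sum.neutral) (auto simp: auxiliary_zero_def)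
    finally show ?thesis using assms(3) that by (auto simp: auxiliary_zero_def)
  qed
  ultimately show ?thesis by (simp add: lyapunov_def)
qed

lemma lyapunov_tendsto:
  assumes "valid_network S" "converges_to S x xe"
  shows "((\<lambda>t. lyapunov S \<theta>s ls (x t)) \<longlongrightarrow> lyapunov S \<theta>s ls xe) at_top"
  unfolding lyapunov_def
proof (intro tendsto_intros)
  show "((\<lambda>t. fst (x t) i k) \<longlongrightarrow> fst xe i k) at_top" if "i \<in> nodes S" "k \<in> {1..rho S i}" for i k
    using assms(2) that by (simp add: converges_to_def)
  show "2 * gb S i k \<noteq> 0" if "i \<in> nodes S" "k \<in> {1..rho S i}" for i k
    using valid_networkD(7)[OF assms(1) that] by simp
  show "((\<lambda>t. snd (x t) j k) \<longlongrightarrow> snd xe j k) at_top" if "j \<in> edges S" "k \<in> {1..rhoh S j}" for j k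
    using assms(2) that by (simp add: converges_to_def)
  show "2 * gbh S j k \<noteq> 0" if "j \<in> edges S" "k \<in> {1..rhoh S j}" for j k
    using valid_networkD(8)[OF assms(1) that] by simp
qed

lemma solutionD:
  assumes "solution S x0 U x"
  shows "state_eq S (x 0) x0" "\<And>t. 0 \<le> t \<Longrightarrow> tau_nonneg S (x t)"
    and "\<And>i k. \<lbrakk>i \<in> nodes S; k \<in> {2..rho S i}\<rbrakk> \<Longrightarrow> (\<lambda>t. fst (U t x) i k) \<in> borel_measurable (lebesgue_on {0..})"
    and "\<And>j k. \<lbrakk>j \<in> edges S; k \<in> {2..rhoh S j}\<rbrakk> \<Longrightarrow> (\<lambda>t. snd (U t x) j k) \<in> borel_measurable (lebesgue_on {0..})"
    and "\<And>i k t. \<lbrakk>i \<in> nodes S; k \<in> {1..rho S i}; 0 \<le> t\<rbrakk> \<Longrightarrow>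
      (\<lambda>s. fst (vfield S (x s) (U s x)) i k) absolutely_integrable_on {0..t}"
    and "\<And>i k t. \<lbrakk>i \<in> nodes S; k \<in> {1..rho S i}; 0 \<le> t\<rbrakk> \<Longrightarrow>
      fst (x t) i k = fst (x 0) i k + integral {0..t} (\<lambda>s. fst (vfield S (x s) (U s x)) i k)"
    and "\<And>j k t. \<lbrakk>j \<in> edges S; k \<in> {1..rhoh S j}; 0 \<le> t\<rbrakk> \<Longrightarrow>
      (\<lambda>s. snd (vfield S (x s) (U s x)) j k) absolutely_integrable_on {0..t}"
    and "\<And>j k t. \<lbrakk>j \<in> edges S; k \<in> {1..rhoh S j}; 0 \<le> t\<rbrakk> \<Longrightarrow>
      snd (x t) j k = snd (x 0) j k + integral {0..t} (\<lambda>s. snd (vfield S (x s) (U s x)) j k)"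
  using assms unfolding solution_def by blast+

text \<open>\<open>lyapunov\<close> is a finite weighted sum of squares of coordinates that are
  indefinite integrals, so \<open>indefinite_integral_square\<close> applies to each
  summand.\<close>

lemma lyapunov_along_solution:
  assumes "valid_network S" "solution S x0 U x" "0 \<le> T"
  shows "(\<lambda>t. lyapunov_rate S \<theta>s ls (x t) (U t x)) absolutely_integrable_on {0..T}"
    and "integral {0..T} (\<lambda>t. lyapunov_rate S \<theta>s ls (x t) (U t x)) =
      lyapunov S \<theta>s ls (x T) - lyapunov S \<theta>s ls (x 0)"
proof -
  note v = valid_networkD[OF assms(1)]
  have scaled: "(\<lambda>t. (X t - c) * f t / b) absolutely_integrable_on {0..T}"
      "((\<lambda>t. (X t - c) * f t / b) has_integral (X T - c)\<^sup>2 / (2 * b) - (X 0 - c)\<^sup>2 / (2 * b)) {0..T}"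
    if "f absolutely_integrable_on {0..T}" "\<And>t. t \<in> {0..T} \<Longrightarrow> X t = X 0 + integral {0..t} f"
    for f X :: "real \<Rightarrow> real" and b c
  proof -
    note sq = indefinite_integral_square[OF assms(3) that, of c]
    show "(\<lambda>t. (X t - c) * f t / b) absolutely_integrable_on {0..T}"
      using set_integrable_divide[of b, OF sq(1)] by simp
    have "((\<lambda>t. (X t - c) * f t) has_integral ((X T - c)\<^sup>2 - (X 0 - c)\<^sup>2) / 2) {0..T}"
      using sq by (metis absolutely_integrable_on_def integrable_integral)
    from has_integral_divide[OF this, of b]
    show "((\<lambda>t. (X t - c) * f t / b) has_integral (X T - c)\<^sup>2 / (2 * b) - (X 0 - c)\<^sup>2 / (2 * b)) {0..T}"
      by (simp add: diff_divide_distrib)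
  qed
  note sol = solutionD[OF assms(2)]
  have node: "fst (x t) i k = fst (x 0) i k + integral {0..t} (\<lambda>s. fst (vfield S (x s) (U s x)) i k)"
    if "i \<in> nodes S" "k \<in> {1..rho S i}" "t \<in> {0..T}" for i k t
    by (rule sol(6)) (use that in auto)
  have edge: "snd (x t) j k = snd (x 0) j k + integral {0..t} (\<lambda>s. snd (vfield S (x s) (U s x)) j k)"
    if "j \<in> edges S" "k \<in> {1..rhoh S j}" "t \<in> {0..T}" for j k t
    by (rule sol(8)) (use that in auto)
  show "(\<lambda>t. lyapunov_rate S \<theta>s ls (x t) (U t x)) absolutely_integrable_on {0..T}"
    unfolding lyapunov_rate_def
    by (intro set_integral_add(1) absolutely_integrable_sum scaled sol(5,7) node edge v(1,2) finite_atLeastAtMost assms(3))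
  have "((\<lambda>t. lyapunov_rate S \<theta>s ls (x t) (U t x)) has_integral
      (\<Sum>i\<in>nodes S. \<Sum>k=1..rho S i. (fst (x T) i k - (if k = 1 then \<theta>s i else 0))\<^sup>2 / (2 * gb S i k) -
         (fst (x 0) i k - (if k = 1 then \<theta>s i else 0))\<^sup>2 / (2 * gb S i k)) +
      (\<Sum>j\<in>edges S. \<Sum>k=1..rhoh S j. (snd (x T) j k - (if k = 1 then ls j else 0))\<^sup>2 / (2 * gbh S j k) -
         (snd (x 0) j k - (if k = 1 then ls j else 0))\<^sup>2 / (2 * gbh S j k))) {0..T}"
    unfolding lyapunov_rate_def
    by (intro has_integral_add has_integral_sum scaled sol(5,7) node edge v(1,2) finite_atLeastAtMost assms(3))
  then show "integral {0..T} (\<lambda>t. lyapunov_rate S \<theta>s ls (x t) (U t x)) =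
      lyapunov S \<theta>s ls (x T) - lyapunov S \<theta>s ls (x 0)"
    unfolding sum_subtractf by (subst integral_unique, assumption) (simp add: lyapunov_def)
qed

text \<open>State coordinates are indefinite integrals, hence continuous on every
  \<open>{0..real n}\<close>; the inputs are measurable by the definition of
  \<open>solution\<close>.\<close>

lemma excess_measurable:
  assumes "valid_network S" "solution S x0 U x"
  shows "(\<lambda>t. input_normsq S (excess_input S (x t) (U t x))) \<in> borel_measurable (lebesgue_on {0..})"
proof -
  have state: "X \<in> borel_measurable (lebesgue_on {0..})"
    if f: "\<And>t. 0 \<le> t \<Longrightarrow> f absolutely_integrable_on {0..t}"
      and X: "\<And>t. 0 \<le> t \<Longrightarrow> X t = X 0 + integral {0..t} f" for f X :: "real \<Rightarrow> real"
  proof (rule borel_measurable_lebesgue_on_Ici)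
    fix n :: nat
    have "continuous_on {0..real n} (\<lambda>t. X 0 + integral {0..t} f)"
      using f[of "real n"]
      by (intro continuous_intros indefinite_integral_continuous_1) (simp add: absolutely_integrable_on_def)
    then have "continuous_on {0..real n} X"
      by (rule continuous_on_eq) (rule X[symmetric], simp)
    then show "X \<in> borel_measurable (lebesgue_on {0..real n})"
      by (intro continuous_imp_measurable_on_sets_lebesgue) auto
  qed
  note sol = solutionD[OF assms(2)]
  have "(\<lambda>t. fst (x t) i k) \<in> borel_measurable (lebesgue_on {0..})"
    if "i \<in> nodes S" "k \<in> {2..rho S i}" for i k
  proof (rule state)
    fix t :: real assume "0 \<le> t"
    then show "(\<lambda>s. fst (vfield S (x s) (U s x)) i k) absolutely_integrable_on {0..t}"
      by (intro sol(5)) (use that in auto)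
    show "fst (x t) i k = fst (x 0) i k + integral {0..t} (\<lambda>s. fst (vfield S (x s) (U s x)) i k)"
      by (rule sol(6)) (use that \<open>0 \<le> t\<close> in auto)
  qed
  moreover have "(\<lambda>t. snd (x t) j k) \<in> borel_measurable (lebesgue_on {0..})"
    if "j \<in> edges S" "k \<in> {2..rhoh S j}" for j k
  proof (rule state)
    fix t :: real assume "0 \<le> t"
    then show "(\<lambda>s. snd (vfield S (x s) (U s x)) j k) absolutely_integrable_on {0..t}"
      by (intro sol(7)) (use that in auto)
    show "snd (x t) j k = snd (x 0) j k + integral {0..t} (\<lambda>s. snd (vfield S (x s) (U s x)) j k)"
      by (rule sol(8)) (use that \<open>0 \<le> t\<close> in auto)
  qed
  ultimately show ?thesis
    unfolding input_normsq_def excess_input_def apd_feedback_def fst_conv snd_conv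
    by (intro borel_measurable_add borel_measurable_sum borel_measurable_times borel_measurable_power
        borel_measurable_diff borel_measurable_const sol(3,4))
qed

lemma running_cost_nonneg:
  assumes "valid_network S" "optimal_solution S \<theta>s ls" "tau_nonneg S x"
  shows "0 \<le> running_cost S \<theta>s ls x w"
proof -
  have "0 \<le> (\<Sum>i\<in>nodes S. \<Sum>k=2..rho S i. ga S i k / (2 * gb S i k) * (fst x i k)\<^sup>2) +
    (\<Sum>j\<in>edges S. \<Sum>k=2..rhoh S j. gah S j k / (2 * gbh S j k) * (snd x j k)\<^sup>2)"
    by (intro add_nonneg_nonneg sum_nonneg mult_nonneg_nonneg divide_nonneg_nonneg)
       (auto intro!: less_imp_le valid_networkD[OF assms(1)])
  from this running_cost_lower_bound[OF assms] show ?thesis by (rule order_trans)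
qed

lemma total_cost_eq_nn_integral:
  assumes "valid_network S" "optimal_solution S \<theta>s ls" "solution S x0 U x"
  shows "total_cost S \<theta>s ls U x =
    enn2ereal (\<integral>\<^sup>+ t. ennreal (running_cost S \<theta>s ls (x t) (U t x)) \<partial>lebesgue_on {0..})"
proof -
  have "(\<integral>\<^sup>+ t. ennreal (- running_cost S \<theta>s ls (x t) (U t x)) \<partial>lebesgue_on {0..}) =
      (\<integral>\<^sup>+ t. 0 \<partial>lebesgue_on {0::real..})"
  proof (rule nn_integral_cong)
    fix t :: real assume "t \<in> space (lebesgue_on {0..})"
    then have "tau_nonneg S (x t)" by (intro solutionD[OF assms(3)]) simp
    then show "ennreal (- running_cost S \<theta>s ls (x t) (U t x)) = 0"
      using running_cost_nonneg[OF assms(1,2)] by (simp add: ennreal_neg)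
  qed
  then show ?thesis by (simp add: total_cost_def zero_ennreal.rep_eq)
qed

text \<open>The dissipation identity applies to the running cost because \<open>lyapunov\<close>
  tends to its value at \<open>xe\<close>, which is 0. Only the integral then depends on the
  control.\<close>

lemma total_cost_of_auxiliary_zero:
  assumes "valid_network S" "optimal_solution S \<theta>s ls" "solution S x0 U x"
    and "converges_to S x xe" "outputs_at S xe \<theta>s ls" "auxiliary_zero S xe"
  shows "total_cost S \<theta>s ls U x =
    enn2ereal ((\<integral>\<^sup>+ t. ennreal (input_normsq S (excess_input S (x t) (U t x))) \<partial>lebesgue_on {0..}) +
      ennreal (lyapunov S \<theta>s ls x0))"
proof -
  note tau = solutionD(2)[OF assms(3)]
  \<comment> \<open>A solution starts at \<open>x0\<close> only up to
    \<open>state_eq\<close>.\<close>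
  have "lyapunov S \<theta>s ls (x 0) = lyapunov S \<theta>s ls x0"
    by (intro lyapunov_cong solutionD(1)[OF assms(3)])
  moreover have "(\<integral>\<^sup>+ t. ennreal (running_cost S \<theta>s ls (x t) (U t x)) \<partial>lebesgue_on {0..}) =
      (\<integral>\<^sup>+ t. ennreal (input_normsq S (excess_input S (x t) (U t x))) \<partial>lebesgue_on {0..}) +
      ennreal (lyapunov S \<theta>s ls (x 0))"
  proof (rule nn_integral_dissipation)
    show "((\<lambda>t. lyapunov S \<theta>s ls (x t)) \<longlongrightarrow> 0) at_top"
      using lyapunov_tendsto[OF assms(1,4)] lyapunov_eq_0[OF assms(1,5,6)] by metis
  qed (use running_cost_nonneg[OF assms(1,2) tau] input_normsq_nonneg[OF assms(1)]
        running_cost_eq_excess_minus_rate[OF assms(1,2) tau] lyapunov_along_solution[OF assms(1,3)]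
        lyapunov_nonneg[OF assms(1)] excess_measurable[OF assms(1,3)] in \<open>simp_all\<close>)
  ultimately show ?thesis by (simp add: total_cost_eq_nn_integral[OF assms(1-3)])
qed

text \<open>An equilibrium of the controlled system may have nonzero auxiliary states, balanced by a
  constant input; then the quadratic terms of the running cost do not vanish in the limit.\<close>

lemma total_cost_infinite:
  assumes "valid_network S" "optimal_solution S \<theta>s ls" "solution S x0 U x"
    and "converges_to S x xe" "\<not> auxiliary_zero S xe"
  shows "total_cost S \<theta>s ls U x = \<infinity>"
proof -
  note v = valid_networkD[OF assms(1)]
  \<comment> \<open>\<open>B\<close> is the lower bound from
    \<open>running_cost_lower_bound\<close>; being continuous in the auxiliary components, it
    converges along the trajectory.\<close>
  define B where "B y = (\<Sum>i\<in>nodes S. \<Sum>k=2..rho S i. ga S i k / (2 * gb S i k) * (fst y i k)\<^sup>2) +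
    (\<Sum>j\<in>edges S. \<Sum>k=2..rhoh S j. gah S j k / (2 * gbh S j k) * (snd y j k)\<^sup>2)" for y :: "('a, 'b) state"
  have pos: "0 < ga S i k / (2 * gb S i k)" if "i \<in> nodes S" "k \<in> {2..rho S i}" for i k
    using v(7)[of i k] v(9)[of i k] that by simp
  have posh: "0 < gah S j k / (2 * gbh S j k)" if "j \<in> edges S" "k \<in> {2..rhoh S j}" for j k
    using v(8)[of j k] v(10)[of j k] that by simp
  have fn: "0 \<le> ga S i k / (2 * gb S i k) * (fst xe i k)\<^sup>2" if "i \<in> nodes S" "k \<in> {2..rho S i}" for i k
    using less_imp_le[OF pos[OF that]] by (intro mult_nonneg_nonneg) auto
  have gn: "0 \<le> gah S j k / (2 * gbh S j k) * (snd xe j k)\<^sup>2" if "j \<in> edges S" "k \<in> {2..rhoh S j}" for j k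
    using less_imp_le[OF posh[OF that]] by (intro mult_nonneg_nonneg) auto
  have n: "0 \<le> (\<Sum>i\<in>nodes S. \<Sum>k=2..rho S i. ga S i k / (2 * gb S i k) * (fst xe i k)\<^sup>2)"
    by (intro sum_nonneg fn)
  have nh: "0 \<le> (\<Sum>j\<in>edges S. \<Sum>k=2..rhoh S j. gah S j k / (2 * gbh S j k) * (snd xe j k)\<^sup>2)"
    by (intro sum_nonneg gn)
  consider i k where "i \<in> nodes S" "k \<in> {2..rho S i}" "fst xe i k \<noteq> 0"
    | j k where "j \<in> edges S" "k \<in> {2..rhoh S j}" "snd xe j k \<noteq> 0"
    using assms(5) by (auto simp: auxiliary_zero_def)
  then have "0 < B xe"
  proof cases
    case 1
    have "0 < ga S i k / (2 * gb S i k) * (fst xe i k)\<^sup>2"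
      using pos[OF 1(1,2)] 1(3) by (intro mult_pos_pos) auto
    then have "0 < (\<Sum>k=2..rho S i. ga S i k / (2 * gb S i k) * (fst xe i k)\<^sup>2)"
      by (intro sum_pos2[OF _ 1(2)] fn 1) auto
    then have "0 < (\<Sum>i\<in>nodes S. \<Sum>k=2..rho S i. ga S i k / (2 * gb S i k) * (fst xe i k)\<^sup>2)"
      by (intro sum_pos2[OF v(1) 1(1)] sum_nonneg fn)
    with nh show ?thesis unfolding B_def by linarith
  next
    case 2
    have "0 < gah S j k / (2 * gbh S j k) * (snd xe j k)\<^sup>2"
      using posh[OF 2(1,2)] 2(3) by (intro mult_pos_pos) auto
    then have "0 < (\<Sum>k=2..rhoh S j. gah S j k / (2 * gbh S j k) * (snd xe j k)\<^sup>2)"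
      by (intro sum_pos2[OF _ 2(2)] gn 2) auto
    then have "0 < (\<Sum>j\<in>edges S. \<Sum>k=2..rhoh S j. gah S j k / (2 * gbh S j k) * (snd xe j k)\<^sup>2)"
      by (intro sum_pos2[OF v(2) 2(1)] sum_nonneg gn)
    with n show ?thesis unfolding B_def by linarith
  qed
  have "((\<lambda>t. B (x t)) \<longlongrightarrow> B xe) at_top"
    unfolding B_def
  proof (intro tendsto_intros)
    show "((\<lambda>t. fst (x t) i k) \<longlongrightarrow> fst xe i k) at_top" if "i \<in> nodes S" "k \<in> {2..rho S i}" for i k
      using assms(4) that by (simp add: converges_to_def)
    show "((\<lambda>t. snd (x t) j k) \<longlongrightarrow> snd xe j k) at_top" if "j \<in> edges S" "k \<in> {2..rhoh S j}" for j k
      using assms(4) that by (simp add: converges_to_def)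
  qed
  \<comment> \<open>Half of the positive limit serves as an eventual lower bound for the running
    cost.\<close>
  then have "\<forall>\<^sub>F t in at_top. B xe / 2 < B (x t)"
    by (rule order_tendstoD) (use \<open>0 < B xe\<close> in simp)
  then have "\<forall>\<^sub>F t in at_top. B xe / 2 \<le> running_cost S \<theta>s ls (x t) (U t x)"
    using eventually_ge_at_top[of "0::real"]
  proof eventually_elim
    case (elim t)
    then have "tau_nonneg S (x t)" by (intro solutionD[OF assms(3)]) simp
    from running_cost_lower_bound[OF assms(1,2) this, of "U t x"] elim show ?case
      unfolding B_def by linarith
  qed
  then have "(\<integral>\<^sup>+ t. ennreal (running_cost S \<theta>s ls (x t) (U t x)) \<partial>lebesgue_on {0..}) = \<infinity>"
    using \<open>0 < B xe\<close> by (intro nn_integral_lebesgue_on_Ici_infinite[of "B xe / 2"]) auto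
  then show ?thesis by (simp add: total_cost_eq_nn_integral[OF assms(1-3)])
qed

section \<open>Equilibria of the feedback system and optimality\<close>

lemma outputs_at_omega_eta:
  assumes "outputs_at S x \<theta>s ls"
  shows "omega S (theta S x) = omega S \<theta>s" "eta S (theta S x) (lam S x) = eta S \<theta>s ls"
proof -
  show o: "omega S (theta S x) = omega S \<theta>s"
    using assms by (auto simp: outputs_at_def omega_def)
  show "eta S (theta S x) (lam S x) = eta S \<theta>s ls"
    using assms by (auto simp: outputs_at_def eta_def o)
qed

text \<open>At a node stationarity gives \<open>phi = 0\<close>, leaving only the feedback term,
  which must vanish. At an edge a positive auxiliary component would make the projection inactive,
  and equilibrium would equate a nonpositive multiple of the constraint value with a positive
  feedback term.\<close>

lemma apd_equilibrium_auxiliary_zero: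
  assumes "valid_network S" "optimal_solution S \<theta>s ls"
    and "equilibrium_under S (apd_feedback S x) x" "outputs_at S x \<theta>s ls"
  shows "auxiliary_zero S x"
proof -
  note v = valid_networkD[OF assms(1)]
  note cong = outputs_at_omega_eta[OF assms(4)]
  have eq: "state_eq S (vfield S x (apd_feedback S x)) (\<lambda>_ _. 0, \<lambda>_ _. 0)" and tau: "tau_nonneg S x"
    using assms(3) by (auto simp: equilibrium_under_def)
  have "fst x i k = 0" if i: "i \<in> nodes S" and k: "k \<in> {2..rho S i}" for i k
  proof -
    have "phi S (theta S x) (lam S x) i = 0"
      using assms(2,4) i by (simp add: phi_def cong optimal_solution_def outputs_at_def neg_eq_iff_add_eq_0)
    moreover have "fst (vfield S x (apd_feedback S x)) i k = 0"
      using eq i k by (simp add: state_eq_def)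
    ultimately show ?thesis
      using v(9)[OF i k] k by (simp add: vfield_def Io_def apd_feedback_def)
  qed
  moreover have "snd x j k = 0" if j: "j \<in> edges S" and k: "k \<in> {2..rhoh S j}" for j k
  proof (rule ccontr)
    assume "snd x j k \<noteq> 0"
    then have p: "0 < snd x j k" using tau j k by (auto simp: tau_nonneg_def less_le)
    have "snd (vfield S x (apd_feedback S x)) j k = 0"
      using eq j k by (simp add: state_eq_def)
    then have "gbh S j k * conH S j (omega S \<theta>s j) = gah S j k * snd x j k"
      using p k by (simp add: vfield_def Io_def apd_feedback_def proj_def cong)
    moreover have "gbh S j k * conH S j (omega S \<theta>s j) \<le> 0"
      using assms(2) j v(8)[OF j, of k] k by (simp add: optimal_solution_def mult_nonneg_nonpos)
    moreover have "0 < gah S j k * snd x j k" using v(10)[OF j k] p by simp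
    ultimately show False by linarith
  qed
  ultimately show ?thesis by (simp add: auxiliary_zero_def)
qed

text \<open>Uniqueness is almost everywhere in time because inputs on a null set affect neither
  trajectory nor cost. The feedback in it is evaluated along the trajectory \<open>x\<close> of the
  competing control.\<close>

theorem corollary5:
  fixes S :: "('v, 'e) network"
    and x0 :: "('v, 'e) state"
    and \<theta>s :: "'v \<Rightarrow> real" and ls :: "'e \<Rightarrow> real"
    and xbar :: "real \<Rightarrow> ('v, 'e) state"
  assumes "valid_network S"
    and "tau_nonneg S x0"
    and "optimal_solution S \<theta>s ls"
    and "apd_converges S x0 \<theta>s ls xbar"
  shows "optimal_control S x0 \<theta>s ls (apd_control S) xbar \<and>
    (\<forall>U x. optimal_control S x0 \<theta>s ls U x \<longrightarrow>
       (AE t in lebesgue_on {0..}. input_eq S (U t x) (apd_control S t x)))"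
proof -
  let ?V = "ennreal (lyapunov S \<theta>s ls x0)"
  let ?X = "\<lambda>U x. \<integral>\<^sup>+ t. ennreal (input_normsq S (excess_input S (x t) (U t x))) \<partial>lebesgue_on {0..}"
  obtain xe where xe: "equilibrium_under S (apd_feedback S xe) xe" "outputs_at S xe \<theta>s ls" "converges_to S xbar xe"
    and sol: "solution S x0 (apd_control S) xbar"
    using assms(4) by (auto simp: apd_converges_def)
  have "causal S (apd_control S)"
    by (auto simp: causal_def apd_control_def apd_feedback_def input_eq_def state_eq_def)
  then have stab: "stabilizing S x0 \<theta>s ls (apd_control S) xbar"
    using xe sol unfolding stabilizing_def equilibrium_def by blast
  \<comment> \<open>Along its own trajectory the feedback has zero excess input, so it attains
    exactly the initial value of \<open>lyapunov\<close>.\<close>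
  have "?X (apd_control S) xbar = 0"
    by (simp add: apd_control_def excess_input_def input_normsq_def)
  then have apd_cost: "total_cost S \<theta>s ls (apd_control S) xbar = enn2ereal ?V"
    using total_cost_of_auxiliary_zero[OF assms(1,3) sol xe(3,2)
        apd_equilibrium_auxiliary_zero[OF assms(1,3) xe(1,2)]] by simp
  \<comment> \<open>The case distinction is whether the limit equilibrium has nonzero auxiliary
    components; both outcomes cost at least \<open>?V\<close>.\<close>
  have cost: "total_cost S \<theta>s ls U x = \<infinity> \<or> total_cost S \<theta>s ls U x = enn2ereal (?X U x + ?V)"
    if "stabilizing S x0 \<theta>s ls U x" for U x
    using that total_cost_of_auxiliary_zero[OF assms(1,3)] total_cost_infinite[OF assms(1,3)]
    unfolding stabilizing_def by blast
  have "total_cost S \<theta>s ls (apd_control S) xbar \<le> total_cost S \<theta>s ls U x"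
    if "stabilizing S x0 \<theta>s ls U x" for U x
    using cost[OF that] by (auto simp: apd_cost simp flip: less_eq_ennreal.rep_eq)
  moreover have "AE t in lebesgue_on {0..}. input_eq S (U t x) (apd_control S t x)"
    if opt: "optimal_control S x0 \<theta>s ls U x" for U x
  proof -
    have U: "stabilizing S x0 \<theta>s ls U x" "total_cost S \<theta>s ls U x \<le> enn2ereal ?V"
      using opt stab unfolding optimal_control_def apd_cost[symmetric] by blast+
    \<comment> \<open>Finiteness of \<open>?V\<close> excludes infinite cost here, and in the next
      step allows cancelling it.\<close>
    then have "?X U x + ?V \<le> ?V"
      using cost[OF U(1)] by (auto simp flip: less_eq_ennreal.rep_eq)
    then have "?X U x = 0"
      using ennreal_add_left_cancel_le[of ?V "?X U x" 0] by (simp add: add.commute)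
    moreover have "(\<lambda>t. input_normsq S (excess_input S (x t) (U t x))) \<in> borel_measurable (lebesgue_on {0..})"
      using U(1) by (intro excess_measurable[OF assms(1)]) (auto simp: stabilizing_def)
    ultimately have "AE t in lebesgue_on {0..}. ennreal (input_normsq S (excess_input S (x t) (U t x))) = 0"
      using measurable_compose[OF _ measurable_ennreal] by (subst (asm) nn_integral_0_iff_AE) auto
    then show ?thesis
    proof eventually_elim
      case (elim t)
      then have "input_normsq S (excess_input S (x t) (U t x)) = 0"
        using input_normsq_nonneg[OF assms(1)] by (simp add: ennreal_eq_0_iff antisym)
      from input_normsq_eq_0D[OF assms(1) this] show ?case
        by (simp add: input_eq_def excess_input_def apd_control_def)
    qed
  qed
  ultimately show ?thesis using stab by (simp add: optimal_control_def)
qed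

end
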